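(* Let $a,b,c\ge 0$ be integers and $n=2^a10^b26^c$. For $0\le k\le\min(a,b)$ let $\Gamma_k$ be the set of ordered pairs of sequences produced by the construction described in the context from $a-k$ seeds of length 2, $b-k$ seeds of length 10, $k$ seeds of length 20 and $c$ seeds of length 26. Then the elements of $\bigcup_{k=0}^{\min(a,b)}\Gamma_k$ are 2-phase Golay complementary sequences (ordered pairs) of length $n$, and the number of them so constructed is $$N=\sum_{k=0}^{\min(a,b)}\frac{((a+b+c-k)!)^2}{(a-k)!\,(b-k)!\,k!\,c!}\,2^{a+5b+4c-2k+2}.$$
   Context: A 2-phase Golay complementary sequence (GCS) of length $n$ is an ordered pair $(A,B)$ of $\pm1$ sequences of length $n$ with $\mathcal C_A(u)+\mathcal C_B(u)=0$ for all integers $u\neq0$, where $\mathcal C_A(u)=\sum_i A[i]\overline{A[i+u]}$ (entries outside the index range are $0$). Notation: $*$ is reverse conjugation (for arrays, reverse every dimension and conjugate all entries). Operation $M$: for a nontrivial (length $>1$) 2-phase GCS $(A,B)$, an array pair $(C,D)$ (multi-index $j$) and a sequence pair $(E,F)$ (index $l$), put $P=\frac14[A+B+(B^*-A^* )]$, $Q=\frac14[A+B-(B^*-A^* )]$ and let $M(A,B,C,D,E,F)=(G,K)$ with $G[j,i,l]=(P[i]C[j]+Q[i]D[j])E[l]+(Q^*[i]C[j]-P^*[i]D[j])F[l]$, $K[j,i,l]=(Q[i]C^*[j]-P[i]D^*[j])E[l]-(P^*[i]C^*[j]+Q^*[i]D^*[j])F[l]$. 2-phase seeds: $A_2=[1,1]$,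 $B_2=[1,-1]$; $A_{10-1}=[1,1,-1,1,-1,1,-1,-1,1,1]$, $B_{10-1}=[1,1,-1,1,1,1,1,1,-1,-1]$; $A_{10-2}=[1,1,1,1,1,-1,1,-1,-1,1]$, $B_{10-2}=[1,1,-1,-1,1,1,1,-1,1,-1]$; $A_{20}=[1,1,1,1,-1,1,-1,-1,-1,1,1,-1,-1,1,1,-1,1,-1,-1,1]$, $B_{20}=[1,1,1,1,-1,1,1,1,1,1,-1,-1,-1,1,-1,1,-1,1,1,-1]$; $A_{26}=[1,1,1,1,-1,1,1,-1,-1,1,-1,1,-1,1,-1,-1,1,-1,1,1,1,-1,-1,1,1,1]$, $B_{26}=[1,1,1,1,-1,1,1,-1,-1,1,-1,1,1,1,1,1,-1,1,-1,-1,-1,1,1,-1,-1,-1]$. Allowed seed pairs: $P_2=\{(A_2,B_2)\}$; $P_{10}=\{(A_{10-1},B_{10-1}),(A_{10-1},B_{10-1}^* ),(A_{10-2},B_{10-2}),(A_{10-2},B_{10-2}^* )\}$; $P_s=\{(A_s,B_s),(A_s,B_s^* )\}$ for $s=20,26$. Construction from $a'$ seeds of length 2, $b'$ of length 10, $c'$ of length 20, $d'$ of length 26, with $r=a'+b'+c'+d'$; the output is the set of all pairs obtained by all possible choices in the following steps. (1) Choose an arrangement $(s_1,\dots,s_r)$ of the multiset of seed lengths. (2) Choose for each $j$ a pair $(A_j,B_j)\in P_{s_j}$. Let $(G_0,K_0)=([1],[1])$ and, for $j=1,\dots,r$, $(G_j,K_j)=M(A_j,B_j,G_{j-1},\epsilon_jK_{j-1},[1],\delta_j[1])$,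 where $\epsilon_j,\delta_j\in\{1,-1\}$ are chosen freely if $s_j\in\{10,20,26\}$ and $\epsilon_j=\delta_j=1$ if $s_j=2$. Dimensions of size 1 are dropped, so $(G_r,K_r)$ is a pair of arrays of size $s_1\times\cdots\times s_r$. (3) Multiply $G_r$ by a sign and $K_r$ by a sign, chosen independently, and for each dimension $k$ either do nothing or apply positional scaling, i.e. multiply both arrays by $(-1)^{i_k}$ ($0\le i_k<s_k$). (4) Choose a permutation $\sigma$ of $\{1,\dots,r\}$ and project both arrays to sequences of length $\prod_k s_k$, the entry at $(i_1,\dots,i_r)$ (0-based) being placed at position $i_{\sigma(1)}+s_{\sigma(1)}i_{\sigma(2)}+s_{\sigma(1)}s_{\sigma(2)}i_{\sigma(3)}+\cdots$. *)

theory Defs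
  imports Complex_Main "HOL-Library.Multiset" "HOL-Combinatorics.Permutations"
begin

text \<open>Sequences are lists. All indices (positions, dimensions, \<open>\<sigma>\<close>) are 0-based.\<close>

definition entry :: "complex list \<Rightarrow> int \<Rightarrow> complex" where
  "entry A i = (if 0 \<le> i \<and> i < int (length A) then A ! nat i else 0)"

definition autocorr :: "complex list \<Rightarrow> int \<Rightarrow> complex" where
  "autocorr A u = (\<Sum>i\<in>{0..<int (length A)}. entry A i * cnj (entry A (i + u)))"

definition golay2 :: "nat \<Rightarrow> complex list \<times> complex list \<Rightarrow> bool" where
  "golay2 n = (\<lambda>(A, B). length A = n \<and> length B = n \<and>
     set A \<subseteq> {1, -1} \<and> set B \<subseteq> {1, -1} \<and>
     (\<forall>u. u \<noteq> 0 \<longrightarrow> autocorr A u + autocorr B u = 0))"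

definition star :: "complex list \<Rightarrow> complex list" where
  "star A = map cnj (rev A)"

text \<open>Only the entries at multi-indices inside the box given by the dimensions are meaningful;
  the others are arbitrary and never enter a projected sequence.\<close>

datatype carray = Array (dims: "nat list") (ent: "nat list \<Rightarrow> complex")

definition box :: "nat list \<Rightarrow> nat list set" where
  "box ds = {ix. length ix = length ds \<and> (\<forall>k<length ds. ix ! k < ds ! k)}"

definition array_of_seq :: "complex list \<Rightarrow> carray" where
  "array_of_seq A = Array [length A] (\<lambda>ix. A ! hd ix)"

definition array_star :: "carray \<Rightarrow> carray" where
  "array_star C = Array (dims C) (\<lambda>ix. cnj (ent C (map2 (\<lambda>d i. d - 1 - i) (dims C) ix)))"

definition array_scale :: "complex \<Rightarrow> carray \<Rightarrow> carray" where
  "array_scale z C = Array (dims C) (\<lambda>ix. z * ent C ix)"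

text \<open>\<open>unsqueeze ds\<close> reinserts index 0 at every dimension of size 1.\<close>

fun unsqueeze :: "nat list \<Rightarrow> nat list \<Rightarrow> nat list" where
  "unsqueeze [] ix = []"
| "unsqueeze (d # ds) ix =
     (if d = 1 then 0 # unsqueeze ds ix else hd ix # unsqueeze ds (tl ix))"

definition squeeze :: "carray \<Rightarrow> carray" where
  "squeeze C = Array (filter (\<lambda>d. d \<noteq> 1) (dims C)) (\<lambda>ix. ent C (unsqueeze (dims C) ix))"

definition seqP :: "complex list \<Rightarrow> complex list \<Rightarrow> complex list" where
  "seqP A B = map (\<lambda>i. (A ! i + B ! i + (star B ! i - star A ! i)) / 4) [0..<length A]"

definition seqQ :: "complex list \<Rightarrow> complex list \<Rightarrow> complex list" where
  "seqQ A B = map (\<lambda>i. (A ! i + B ! i - (star B ! i - star A ! i)) / 4) [0..<length A]"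

text \<open>A multi-index of the result is \<open>j @ [i, l]\<close>, with \<open>j\<close> a multi-index of \<open>C\<close> and \<open>D\<close>,
  which are meant to have the same dimensions; likewise \<open>E\<close> and \<open>F\<close> have the same length.\<close>

definition opM :: "complex list \<Rightarrow> complex list \<Rightarrow> carray \<Rightarrow> carray \<Rightarrow> complex list \<Rightarrow> complex list
    \<Rightarrow> carray \<times> carray" where
  "opM A B C D E F =
    (let P = seqP A B; Q = seqQ A B; m = length (dims C); ds = dims C @ [length A, length E];
         g = (\<lambda>j i l. (P ! i * ent C j + Q ! i * ent D j) * E ! l
                    + (star Q ! i * ent C j - star P ! i * ent D j) * F ! l);
         h = (\<lambda>j i l. (Q ! i * ent (array_star C) j - P ! i * ent (array_star D) j) * E ! l
                    - (star P ! i * ent (array_star C) j + star Q ! i * ent (array_star D) j) * F ! l)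
     in (Array ds (\<lambda>ix. g (take m ix) (ix ! m) (ix ! (m + 1))),
         Array ds (\<lambda>ix. h (take m ix) (ix ! m) (ix ! (m + 1)))))"

definition A2 :: "complex list" where "A2 = [1, 1]"
definition B2 :: "complex list" where "B2 = [1, -1]"
definition A10_1 :: "complex list" where "A10_1 = [1,1,-1,1,-1,1,-1,-1,1,1]"
definition B10_1 :: "complex list" where "B10_1 = [1,1,-1,1,1,1,1,1,-1,-1]"
definition A10_2 :: "complex list" where "A10_2 = [1,1,1,1,1,-1,1,-1,-1,1]"
definition B10_2 :: "complex list" where "B10_2 = [1,1,-1,-1,1,1,1,-1,1,-1]"
definition A20 :: "complex list" where
  "A20 = [1,1,1,1,-1,1,-1,-1,-1,1,1,-1,-1,1,1,-1,1,-1,-1,1]"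
definition B20 :: "complex list" where
  "B20 = [1,1,1,1,-1,1,1,1,1,1,-1,-1,-1,1,-1,1,-1,1,1,-1]"
definition A26 :: "complex list" where
  "A26 = [1,1,1,1,-1,1,1,-1,-1,1,-1,1,-1,1,-1,-1,1,-1,1,1,1,-1,-1,1,1,1]"
definition B26 :: "complex list" where
  "B26 = [1,1,1,1,-1,1,1,-1,-1,1,-1,1,1,1,1,1,-1,1,-1,-1,-1,1,1,-1,-1,-1]"

definition seed_pairs :: "nat \<Rightarrow> (complex list \<times> complex list) set" where
  "seed_pairs s =
    (if s = 2 then {(A2, B2)}
     else if s = 10 then {(A10_1, B10_1), (A10_1, star B10_1), (A10_2, B10_2), (A10_2, star B10_2)}
     else if s = 20 then {(A20, B20), (A20, star B20)}
     else if s = 26 then {(A26, B26), (A26, star B26)}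
     else {})"

text \<open>A choice \<open>(A, B, \<epsilon>, \<delta>)\<close> fixes the seed pair and the two signs used in one application of
  \<open>opM\<close>.\<close>

type_synonym seed_choice = "complex list \<times> complex list \<times> complex \<times> complex"

definition seed_choices :: "nat \<Rightarrow> seed_choice set" where
  "seed_choices s = {(A, B, \<epsilon>, \<delta>). (A, B) \<in> seed_pairs s \<and>
     (if s = 2 then \<epsilon> = 1 \<and> \<delta> = 1 else \<epsilon> \<in> {1, -1} \<and> \<delta> \<in> {1, -1})}"

definition build_step :: "seed_choice \<Rightarrow> carray \<times> carray \<Rightarrow> carray \<times> carray" where
  "build_step = (\<lambda>(A, B, \<epsilon>, \<delta>) (G, K).
     map_prod squeeze squeeze (opM A B G (array_scale \<epsilon> K) [1] [\<delta>]))"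

definition build :: "seed_choice list \<Rightarrow> carray \<times> carray" where
  "build cs = fold build_step cs (squeeze (array_of_seq [1]), squeeze (array_of_seq [1]))"

definition positional_scaling :: "nat set \<Rightarrow> carray \<Rightarrow> carray" where
  "positional_scaling T C = Array (dims C) (\<lambda>ix. (\<Prod>k\<in>T. (-1) ^ (ix ! k)) * ent C ix)"

definition position :: "nat list \<Rightarrow> (nat \<Rightarrow> nat) \<Rightarrow> nat list \<Rightarrow> nat" where
  "position ds \<sigma> ix = (\<Sum>m<length ds. (\<Prod>l<m. ds ! \<sigma> l) * ix ! \<sigma> m)"

text \<open>For \<open>\<sigma>\<close> a permutation of the dimensions, \<open>position\<close> maps the box bijectively onto
  \<open>{0..<prod_list (dims C)}\<close>, so the projected sequence exists and is unique.\<close>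

definition projects_to :: "(nat \<Rightarrow> nat) \<Rightarrow> carray \<Rightarrow> complex list \<Rightarrow> bool" where
  "projects_to \<sigma> C x \<longleftrightarrow> length x = prod_list (dims C) \<and>
     (\<forall>ix \<in> box (dims C). x ! position (dims C) \<sigma> ix = ent C ix)"

definition Gamma :: "nat \<Rightarrow> nat \<Rightarrow> nat \<Rightarrow> nat \<Rightarrow> (complex list \<times> complex list) set" where
  "Gamma a' b' c' d' = {(x, y). \<exists>s cs G K \<eta> \<kappa> T \<sigma>.
     mset s = replicate_mset a' 2 + replicate_mset b' 10 + replicate_mset c' 20
              + replicate_mset d' 26 \<and>
     list_all2 (\<lambda>sj ch. ch \<in> seed_choices sj) s cs \<and>
     (G, K) = build cs \<and>
     \<eta> \<in> {1, -1} \<and> \<kappa> \<in> {1, -1} \<and> T \<subseteq> {..<length s} \<and> \<sigma> permutes {..<length s} \<and>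
     projects_to \<sigma> (positional_scaling T (array_scale \<eta> G)) x \<and>
     projects_to \<sigma> (positional_scaling T (array_scale \<kappa> K)) y}"

end

theory Submission
  imports Defs "HOL-Combinatorics.Multiset_Permutations" "HOL-Computational_Algebra.Polynomial"
begin

text \<open>
  For a 2-phase seed \<open>(A, B)\<close> of length \<open>s\<close> one has \<open>A[i] B[i] A[i\<^sup>*] B[i\<^sup>*] = -1\<close> where \<open>i\<^sup>* = s - 1 - i\<close>,
  so that exactly one of \<open>i, i\<^sup>*\<close> lies in \<open>S = {i. A[i] = B[i\<^sup>*]}\<close>. One step of the construction is
  \<open>G'[j, i] = A'[i] G[j]\<close> or \<open>\<epsilon> A'[i] K[j]\<close>, and \<open>K'[j, i] = -\<epsilon> A'[i] K\<^sup>*[j]\<close> or \<open>A'[i] G\<^sup>*[j]\<close>, according to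
  whether \<open>i \<in> S\<close>; here \<open>A' = A\<close> if \<open>\<delta> = 1\<close> and \<open>A' = B\<close> otherwise.

  Complementarity: at points of the unit torus the generating functions satisfy
  \<open>|G'|\<^sup>2 + |K'|\<^sup>2 = (|U|\<^sup>2 + |V|\<^sup>2) (|G|\<^sup>2 + |K|\<^sup>2)\<close>, where \<open>U\<close> and \<open>V\<close> are the parts of \<open>A'\<close> on \<open>S\<close> and off \<open>S\<close>, and
  \<open>|U|\<^sup>2 + |V|\<^sup>2 = s\<close> because the seed is complementary. Positional scaling and projection only
  substitute other unimodular values for the variables.

  Distinctness: \<open>G'[j, i] K'\<^sup>*[j, i] = -\<delta> A[i] B[i]\<close> depends on \<open>i\<close> alone, hence up to sign
  \<open>x[p] y[n - 1 - p]\<close> is the sequence \<open>A B\<close>, each entry repeated \<open>w\<close> times, continued periodically,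
  where \<open>w\<close> is the weight of the last array dimension in the projection. The length of its first run
  and finitely many comparisons of entries determine \<open>w\<close> and the seed. Slicing \<open>x\<close> at an \<open>i\<close> in \<open>S\<close> and
  at one outside \<open>S\<close> yields, up to signs, the pair of the previous step, and induction recovers all choices.
\<close>

section \<open>Mixed radix positions\<close>

text \<open>Radices come first and the least significant digit stands at the head, as in step (4),
  where dimension \<open>\<sigma>(1)\<close> varies fastest.\<close>

fun mixval :: "nat list \<Rightarrow> nat list \<Rightarrow> nat" where
  "mixval (t # ts) (d # ds) = d + t * mixval ts ds"
| "mixval _ _ = 0"

text \<open>A permutation is kept as its list of values, so that dropping the last dimension
  \<open>r - 1\<close> amounts to deleting one list element.\<close>

definition perm_list :: "nat list \<Rightarrow> nat \<Rightarrow> bool" where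
  "perm_list \<pi> r \<longleftrightarrow> distinct \<pi> \<and> set \<pi> = {..<r}"

definition pos :: "nat list \<Rightarrow> nat list \<Rightarrow> nat list \<Rightarrow> nat" where
  "pos ds \<pi> ix = mixval (map ((!) ds) \<pi>) (map ((!) ix) \<pi>)"

definition flip_index :: "nat list \<Rightarrow> nat list \<Rightarrow> nat list" where
  "flip_index ds ix = map2 (\<lambda>d i. d - 1 - i) ds ix"

text \<open>The position obtained from \<open>q\<close> by inserting the digit \<open>i\<close> of radix \<open>s\<close> at weight \<open>w\<close>.\<close>

definition expand :: "nat \<Rightarrow> nat \<Rightarrow> nat \<Rightarrow> nat \<Rightarrow> nat" where
  "expand w s i q = q mod w + w * (i + s * (q div w))"

lemma box_Nil: "box [] = {[]}"
  by (auto simp: box_def)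

lemma box_iff_list_all2: "ix \<in> box ds \<longleftrightarrow> list_all2 (<) ix ds"
  by (auto simp: box_def list_all2_conv_all_nth)

lemma length_box: "ix \<in> box ds \<Longrightarrow> length ix = length ds"
  by (simp add: box_def)

lemma box_Cons: "box (d # ds) = (\<lambda>(i, ix). i # ix) ` ({..<d} \<times> box ds)"
  by (auto simp: box_iff_list_all2 list_all2_Cons2 image_iff)

lemma box_snoc: "box (ds @ [d]) = (\<lambda>(ix, i). ix @ [i]) ` (box ds \<times> {..<d})"
  by (auto simp: box_iff_list_all2 list_all2_append2 list_all2_Cons2 image_iff)
    (metis length_Cons list.size(3) list_all2_lengthD)

lemma snoc_in_box: "ix @ [i] \<in> box (ds @ [d]) \<longleftrightarrow> ix \<in> box ds \<and> i < d"
  by (auto simp: box_snoc)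

lemma in_box_snocE:
  assumes "ix \<in> box (ds @ [d])"
  obtains j i where "ix = j @ [i]" "j \<in> box ds" "i < d"
  using assms by (auto simp: box_snoc)

lemma zeros_in_box: "\<forall>d\<in>set ds. 0 < d \<Longrightarrow> map (\<lambda>_. 0) ds \<in> box ds"
  by (auto simp: box_def)

text \<open>Division with remainder by the first radix: \<open>p\<close> corresponds to
  \<open>p mod d\<close> and \<open>p div d\<close>, and the quotient is treated by
  induction.\<close>

lemma bij_betw_mixval: "bij_betw (mixval ds) (box ds) {..<prod_list ds}"
proof (induction ds)
  case Nil
  then show ?case by (auto simp: box_Nil bij_betw_def)
next
  case (Cons d ds)
  have "bij_betw (\<lambda>(i, ix). i # ix) ({..<d} \<times> box ds) (box (d # ds))"
    unfolding box_Cons by (auto simp: bij_betw_def inj_on_def)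
  moreover have "bij_betw (mixval (d # ds) \<circ> (\<lambda>(i, ix). i # ix)) ({..<d} \<times> box ds) {..<prod_list (d # ds)}"
  proof -
    have "bij_betw (map_prod id (mixval ds)) ({..<d} \<times> box ds) ({..<d} \<times> {..<prod_list ds})"
      by (intro bij_betw_map_prod Cons.IH) simp
    moreover have "bij_betw (\<lambda>(i, q). i + d * q) ({..<d} \<times> {..<prod_list ds}) {..<d * prod_list ds}"
    proof (intro bij_betw_byWitness[where f' = "\<lambda>p. (p mod d, p div d)"])
      show "(\<lambda>(i, q). i + d * q) ` ({..<d} \<times> {..<prod_list ds}) \<subseteq> {..<d * prod_list ds}"
      proof clarsimp
        fix i q assume "i < d" "q < prod_list ds"
        then have "i + d * q < d * Suc q" "d * Suc q \<le> d * prod_list ds"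
          by (simp, intro mult_le_mono) auto
        then show "i + d * q < d * prod_list ds" by linarith
      qed
      show "(\<lambda>p. (p mod d, p div d)) ` {..<d * prod_list ds} \<subseteq> {..<d} \<times> {..<prod_list ds}"
        by (auto simp: less_mult_imp_div_less mult.commute intro!: mod_less_divisor gr0I)
    qed auto
    ultimately have "bij_betw ((\<lambda>(i, q). i + d * q) \<circ> map_prod id (mixval ds))
        ({..<d} \<times> box ds) {..<d * prod_list ds}"
      by (rule bij_betw_trans)
    moreover have "(\<lambda>(i, q). i + d * q) \<circ> map_prod id (mixval ds) = mixval (d # ds) \<circ> (\<lambda>(i, ix). i # ix)"
      by auto
    ultimately show ?thesis by simp
  qed
  ultimately show ?case
    using bij_betw_comp_iff by blast
qed

lemma mixval_less: "ix \<in> box ds \<Longrightarrow> mixval ds ix < prod_list ds"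
  using bij_betw_mixval[of ds] by (auto simp: bij_betw_def)

lemma mixval_append:
  "length ix = length ds \<Longrightarrow> mixval (ds @ ds') (ix @ ix') = mixval ds ix + prod_list ds * mixval ds' ix'"
  by (induction ds ix rule: mixval.induct) (auto simp: algebra_simps)

text \<open>A digit and its complement add up to the largest digit, so no carry occurs and the sum
  is the largest representable number. The additive form avoids truncated subtraction in the
  induction.\<close>

lemma mixval_flip:
  "ix \<in> box ds \<Longrightarrow> mixval ds (flip_index ds ix) + mixval ds ix + 1 = prod_list ds"
proof (induction ds arbitrary: ix)
  case (Cons d ds)
  then obtain i ix' where ix: "ix = i # ix'" "i < d" "ix' \<in> box ds"
    by (auto simp: box_Cons)
  have *: "mixval ds (flip_index ds ix') + mixval ds ix' + 1 = prod_list ds"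
    using Cons.IH ix by blast
  have "d * prod_list ds = d * mixval ds (flip_index ds ix') + d * mixval ds ix' + d"
    unfolding *[symmetric] by (simp add: algebra_simps)
  with ix show ?case by (simp add: flip_index_def)
qed (auto simp: box_Nil flip_index_def)

lemma mixval_eq_sum:
  "length ix = length ds \<Longrightarrow> mixval ds ix = (\<Sum>m<length ds. (\<Prod>l<m. ds ! l) * ix ! m)"
proof (induction ds ix rule: mixval.induct)
  case (1 t ts d ds)
  then show ?case
    by (simp add: sum.lessThan_Suc_shift prod.lessThan_Suc_shift sum_distrib_left mult.assoc del: sum.lessThan_Suc prod.lessThan_Suc)
qed auto

lemma perm_list_length: "perm_list \<pi> r \<Longrightarrow> length \<pi> = r"
  unfolding perm_list_def by (metis card_lessThan distinct_card)

lemma map_nth_perm_in_box: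
  "perm_list \<pi> (length ds) \<Longrightarrow> ix \<in> box ds \<Longrightarrow> map ((!) ix) \<pi> \<in> box (map ((!) ds) \<pi>)"
  by (auto simp: perm_list_def box_def)

lemma prod_list_map_perm:
  fixes ds :: "nat list"
  assumes "perm_list \<pi> (length ds)"
  shows "prod_list (map ((!) ds) \<pi>) = prod_list ds"
proof -
  have "prod_list (map ((!) ds) \<pi>) = (\<Prod>i<length ds. ds ! i)"
    using assms by (metis perm_list_def prod.distinct_set_conv_list)
  also have "\<dots> = prod_list ds"
    by (simp add: prod.list_conv_set_nth atLeast0LessThan)
  finally show ?thesis .
qed

lemma pos_bij:
  assumes \<pi>: "perm_list \<pi> (length ds)"
  shows "bij_betw (pos ds \<pi>) (box ds) {..<prod_list ds}"
proof -
  define r where "r = length ds"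
  have len: "length \<pi> = r" using \<pi> perm_list_length r_def by blast
  have bij: "bij_betw ((!) \<pi>) {..<r} {..<r}"
    using \<pi> len bij_betw_nth[of \<pi> "{..<r}" "{..<r}"] by (simp add: perm_list_def r_def)
  define inv where "inv = inv_into {..<r} ((!) \<pi>)"
  have inv1: "\<pi> ! inv k = k" "inv k < r" if "k < r" for k
    using bij_betw_inv_into_right[OF bij] bij_betw_inv_into[OF bij] that
    by (auto simp: inv_def bij_betw_def)
  have inv2: "inv (\<pi> ! m) = m" if "m < r" for m
    using bij_betw_inv_into_left[OF bij] that by (auto simp: inv_def)
  have lt: "\<pi> ! m < r" if "m < r" for m
    using bij that by (auto simp: bij_betw_def)
  have "bij_betw (\<lambda>ix. map ((!) ix) \<pi>) (box ds) (box (map ((!) ds) \<pi>))"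
  \<comment> \<open>The inverse reads the digit of dimension \<open>k\<close> at the place
    \<open>inv k\<close> where \<open>\<pi>\<close> lists \<open>k\<close>.\<close>
  proof (intro bij_betw_byWitness[where f' = "\<lambda>d. map (\<lambda>k. d ! inv k) [0..<r]"])
    show "(\<lambda>ix. map ((!) ix) \<pi>) ` box ds \<subseteq> box (map ((!) ds) \<pi>)"
      using map_nth_perm_in_box[OF \<pi>] by blast
    show "\<forall>a\<in>box ds. map (\<lambda>k. map ((!) a) \<pi> ! inv k) [0..<r] = a"
      by (auto simp: box_def r_def len inv1[unfolded r_def] intro!: nth_equalityI)
    show "\<forall>a'\<in>box (map ((!) ds) \<pi>). map ((!) (map (\<lambda>k. a' ! inv k) [0..<r])) \<pi> = a'"
      by (auto simp: box_def len inv2 lt nth_map nth_upt intro!: nth_equalityI)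
        (metis inv2 lt nth_map_upt add_0 diff_zero)
    show "(\<lambda>d. map (\<lambda>k. d ! inv k) [0..<r]) ` box (map ((!) ds) \<pi>) \<subseteq> box ds"
    proof clarify
      fix d assume d: "d \<in> box (map ((!) ds) \<pi>)"
      have "d ! inv k < ds ! k" if "k < r" for k
        using d inv1[OF that] len by (auto simp: box_def)
      then show "map (\<lambda>k. d ! inv k) [0..<r] \<in> box ds"
        by (auto simp: box_def r_def)
    qed
  qed
  from bij_betw_trans[OF this bij_betw_mixval]
  have "bij_betw (mixval (map ((!) ds) \<pi>) \<circ> (\<lambda>ix. map ((!) ix) \<pi>)) (box ds) {..<prod_list ds}"
    by (simp add: prod_list_map_perm[OF \<pi>])
  then show ?thesis by (simp add: pos_def[abs_def] o_def)
qed

lemma pos_less: "perm_list \<pi> (length ds) \<Longrightarrow> ix \<in> box ds \<Longrightarrow> pos ds \<pi> ix < prod_list ds"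
  using pos_bij[of \<pi> ds] by (auto simp: bij_betw_def)

lemma pos_surj:
  assumes "perm_list \<pi> (length ds)" "p < prod_list ds"
  obtains ix where "ix \<in> box ds" "pos ds \<pi> ix = p"
  using pos_bij[OF assms(1)] assms(2) unfolding bij_betw_def by (metis imageE lessThan_iff)

lemma flip_index_in_box: "ix \<in> box ds \<Longrightarrow> flip_index ds ix \<in> box ds"
  by (auto simp: box_def flip_index_def)

lemma flip_index_snoc:
  "length ix = length ds \<Longrightarrow> flip_index (ds @ [d]) (ix @ [i]) = flip_index ds ix @ [d - 1 - i]"
  by (simp add: flip_index_def)

lemma flip_flip_index: "ix \<in> box ds \<Longrightarrow> flip_index ds (flip_index ds ix) = ix"
  by (auto simp: box_def flip_index_def intro!: nth_equalityI)

text \<open>Reversing every dimension of an array thus reverses its projected sequence, whichever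
  \<open>\<pi>\<close> is used.\<close>

lemma pos_flip:
  assumes \<pi>: "perm_list \<pi> (length ds)" and ix: "ix \<in> box ds"
  shows "pos ds \<pi> (flip_index ds ix) = prod_list ds - 1 - pos ds \<pi> ix"
proof -
  have lt: "\<pi> ! m < length ds" if "m < length \<pi>" for m
    using \<pi> that nth_mem by (fastforce simp: perm_list_def)
  have "map ((!) (flip_index ds ix)) \<pi> = flip_index (map ((!) ds) \<pi>) (map ((!) ix) \<pi>)"
    using lt ix by (auto simp: box_def flip_index_def intro!: nth_equalityI)
  then show ?thesis
    using mixval_flip[OF map_nth_perm_in_box[OF \<pi> ix]]
    by (simp add: pos_def prod_list_map_perm[OF \<pi>])
qed

text \<open>The dimensions in \<open>\<pi>1\<close> are those projected with smaller weight than the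
  last one, so the product of their radices is the weight of the last dimension.\<close>

lemma perm_list_snocE:
  assumes "perm_list \<pi> (Suc r)"
  obtains \<pi>1 \<pi>2 where "\<pi> = \<pi>1 @ r # \<pi>2" "perm_list (\<pi>1 @ \<pi>2) r"
proof -
  have "r \<in> set \<pi>" using assms by (auto simp: perm_list_def)
  then obtain \<pi>1 \<pi>2 where \<pi>: "\<pi> = \<pi>1 @ r # \<pi>2" by (meson split_list)
  have "perm_list (\<pi>1 @ \<pi>2) r" using assms unfolding perm_list_def \<pi>
    by (auto simp: lessThan_Suc)
  with \<pi> that show ?thesis by blast
qed

text \<open>Split the position without the last dimension into the part \<open>lo\<close> below
  weight \<open>w\<close> and the part \<open>hi\<close> above it; the new digit goes between them
  and multiplies the weight of \<open>hi\<close> by \<open>s\<close>.\<close>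

lemma pos_snoc:
  assumes \<pi>: "perm_list (\<pi>1 @ \<pi>2) (length ds)" and ix: "ix \<in> box ds"
  shows "pos (ds @ [s]) (\<pi>1 @ length ds # \<pi>2) (ix @ [i]) =
    expand (prod_list (map ((!) ds) \<pi>1)) s i (pos ds (\<pi>1 @ \<pi>2) ix)"
proof -
  define w where "w = prod_list (map ((!) ds) \<pi>1)"
  define lo where "lo = mixval (map ((!) ds) \<pi>1) (map ((!) ix) \<pi>1)"
  define hi where "hi = mixval (map ((!) ds) \<pi>2) (map ((!) ix) \<pi>2)"
  have lt: "k < length ds" if "k \<in> set \<pi>1 \<union> set \<pi>2" for k
    using \<pi> that by (auto simp: perm_list_def)
  have len: "length ix = length ds" using ix by (simp add: box_def)
  have "map ((!) ix) \<pi>1 \<in> box (map ((!) ds) \<pi>1)"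
    using ix lt by (auto simp: box_def)
  then have lo: "lo < w" unfolding lo_def w_def by (rule mixval_less)
  have m: "map ((!) (ds @ [s])) \<pi>1 = map ((!) ds) \<pi>1" "map ((!) (ds @ [s])) \<pi>2 = map ((!) ds) \<pi>2"
    "map ((!) (ix @ [i])) \<pi>1 = map ((!) ix) \<pi>1" "map ((!) (ix @ [i])) \<pi>2 = map ((!) ix) \<pi>2"
    using lt len by (auto simp: nth_append)
  have 1: "pos (ds @ [s]) (\<pi>1 @ length ds # \<pi>2) (ix @ [i]) = lo + w * (i + s * hi)"
    unfolding pos_def map_append list.map m using len
    by (simp add: mixval_append lo_def hi_def w_def nth_append)
  have 2: "pos ds (\<pi>1 @ \<pi>2) ix = lo + w * hi"
    unfolding pos_def map_append by (simp add: mixval_append lo_def hi_def w_def)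
  show ?thesis unfolding 1 2 expand_def w_def[symmetric] using lo by simp
qed

lemma digit_expand: "0 < w \<Longrightarrow> i < s \<Longrightarrow> expand w s i q div w mod s = i"
  by (simp add: expand_def)

text \<open>With all radices at least 2 the prefix products strictly increase, so the weight of a
  dimension reveals where it was inserted.\<close>

lemma insertion_point_unique:
  assumes "xs @ ys = xs' @ ys'" "\<forall>k\<in>set (xs @ ys). 2 \<le> (f k :: nat)"
    and "prod_list (map f xs) = prod_list (map f xs')"
  shows "xs = xs'"
proof -
  have aux: "zs = []" if "prod_list (map f us) = prod_list (map f (us @ zs))"
    "\<forall>k\<in>set (us @ zs). 2 \<le> f k" for us zs
  proof (rule ccontr)
    assume "zs \<noteq> []"
    then obtain z zs' where zs: "zs = z # zs'" by (cases zs) auto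
    have pos: "0 < prod_list (map f vs)" if "\<forall>k\<in>set vs. 2 \<le> f k" for vs
      using that by (induction vs) auto
    have "0 < prod_list (map f us)"
      using that(2) by (intro pos) simp
    moreover have "prod_list (map f us) * (f z * prod_list (map f zs')) = prod_list (map f us) * 1"
      using that(1) by (simp only: zs map_append list.map prod_list.append prod_list.Cons mult_1_right)
    ultimately have "f z * prod_list (map f zs') = 1"
      by (metis mult_left_cancel less_irrefl)
    then have "f z = 1" by simp
    moreover have "2 \<le> f z" using that(2) zs by simp
    ultimately show False by simp
  qed
  from assms(1) obtain us where "xs = xs' @ us \<and> us @ ys = ys' \<or> xs @ us = xs' \<and> ys = us @ ys'"
    by (auto simp: append_eq_append_conv2)
  then show ?thesis
    using aux[of xs' us] aux[of xs us] assms(2,3) by fastforce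
qed

section \<open>Sequences projected from an array, and their slices\<close>

definition represents :: "nat list \<Rightarrow> nat list \<Rightarrow> (nat list \<Rightarrow> complex) \<Rightarrow> complex list \<Rightarrow> bool" where
  "represents ds \<pi> g x \<longleftrightarrow> length x = prod_list ds \<and> (\<forall>ix\<in>box ds. x ! pos ds \<pi> ix = g ix)"

lemma represents_unique:
  assumes "perm_list \<pi> (length ds)" "represents ds \<pi> g x" "represents ds \<pi> g x'"
  shows "x = x'"
proof (rule nth_equalityI)
  show "length x = length x'" using assms by (simp add: represents_def)
  fix p assume "p < length x"
  then obtain ix where "ix \<in> box ds" "pos ds \<pi> ix = p"
    using pos_surj[OF assms(1), of p] assms(2) by (auto simp: represents_def)
  then show "x ! p = x' ! p" using assms by (auto simp: represents_def)
qed

lemma represents_exists: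
  assumes \<pi>: "perm_list \<pi> (length ds)"
  shows "\<exists>x. represents ds \<pi> g x"
proof
  define x where "x = map (\<lambda>p. g (inv_into (box ds) (pos ds \<pi>) p)) [0..<prod_list ds]"
  show "represents ds \<pi> g x"
    using pos_bij[OF \<pi>] pos_less[OF \<pi>] by (auto simp: represents_def x_def bij_betw_def)
qed

definition slice :: "nat \<Rightarrow> nat \<Rightarrow> nat \<Rightarrow> nat \<Rightarrow> complex list \<Rightarrow> complex list" where
  "slice w s m i x = map (\<lambda>q. x ! expand w s i q) [0..<m]"

text \<open>Fixing the last array index is the same as fixing one digit of the position, so a slice
  is again a projection, now of an array with one dimension less.\<close>

lemma represents_slice:
  assumes "perm_list (\<pi>1 @ \<pi>2) (length ds)"
    and "represents (ds @ [s]) (\<pi>1 @ length ds # \<pi>2) g x" and "i < s"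
  shows "represents ds (\<pi>1 @ \<pi>2) (\<lambda>j. g (j @ [i]))
    (slice (prod_list (map ((!) ds) \<pi>1)) s (prod_list ds) i x)"
  using assms pos_less[OF assms(1)]
  by (auto simp: represents_def slice_def snoc_in_box simp flip: pos_snoc)

section \<open>The seed pairs\<close>

text \<open>Integer copies of the seeds make the finite checks decidable by evaluation; since all
  entries are real, \<open>star\<close> becomes \<open>rev\<close>.\<close>

definition int_seeds :: "(int list \<times> int list) list" where
  "int_seeds =
    (let a1 = [1,1,-1,1,-1,1,-1,-1,1,1]; b1 = [1,1,-1,1,1,1,1,1,-1,-1];
         a2 = [1,1,1,1,1,-1,1,-1,-1,1]; b2 = [1,1,-1,-1,1,1,1,-1,1,-1];
         a3 = [1,1,1,1,-1,1,-1,-1,-1,1,1,-1,-1,1,1,-1,1,-1,-1,1];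
         b3 = [1,1,1,1,-1,1,1,1,1,1,-1,-1,-1,1,-1,1,-1,1,1,-1];
         a4 = [1,1,1,1,-1,1,1,-1,-1,1,-1,1,-1,1,-1,-1,1,-1,1,1,1,-1,-1,1,1,1];
         b4 = [1,1,1,1,-1,1,1,-1,-1,1,-1,1,1,1,1,1,-1,1,-1,-1,-1,1,1,-1,-1,-1]
     in [([1,1],[1,-1]), (a1, b1), (a1, rev b1), (a2, b2), (a2, rev b2),
         (a3, b3), (a3, rev b3), (a4, b4), (a4, rev b4)])"

lemma seed_pairs_int:
  assumes "(A, B) \<in> seed_pairs s"
  shows "\<exists>(a, b)\<in>set int_seeds. length a = s \<and> A = map of_int a \<and> B = map of_int b"
  using assms
  by (auto simp: seed_pairs_def int_seeds_def Let_def star_def A2_def B2_def A10_1_def B10_1_def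
    A10_2_def B10_2_def A20_def B20_def A26_def B26_def split: if_splits)

lemma int_seeds_basic:
  "\<forall>(a, b)\<in>set int_seeds. length b = length a \<and> 2 \<le> length a \<and> even (length a) \<and>
     (\<forall>x\<in>set (a @ b). x = 1 \<or> x = -1)"
  by code_simp

text \<open>The quadruple product rule for binary Golay pairs; here a finite check over the nine
  seed pairs.\<close>

lemma int_seeds_skew:
  "\<forall>(a, b)\<in>set int_seeds. \<forall>i\<in>set [0..<length a].
     a ! i * b ! i * (a ! (length a - 1 - i) * b ! (length a - 1 - i)) = -1"
  by code_simp

section \<open>Polynomial arithmetic on integer coefficient lists\<close>

fun list_add :: "int list \<Rightarrow> int list \<Rightarrow> int list" where
  "list_add (x # xs) (y # ys) = (x + y) # list_add xs ys"
| "list_add [] ys = ys"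
| "list_add xs [] = xs"

fun list_conv :: "int list \<Rightarrow> int list \<Rightarrow> int list" where
  "list_conv [] ys = []"
| "list_conv (x # xs) ys = list_add (map ((*) x) ys) (0 # list_conv xs ys)"

lemma horner_list_add:
  fixes z :: complex
  shows "horner_sum of_int z (list_add xs ys) = horner_sum of_int z xs + horner_sum of_int z ys"
  by (induction xs ys rule: list_add.induct) (auto simp: algebra_simps)

lemma horner_list_conv:
  fixes z :: complex
  shows "horner_sum of_int z (list_conv xs ys) = horner_sum of_int z xs * horner_sum of_int z ys"
proof (induction xs)
  case (Cons x xs)
  have "horner_sum of_int z (map ((*) x) ys) = of_int x * horner_sum of_int z ys"
    by (induction ys) (auto simp: algebra_simps)
  with Cons show ?case by (simp add: horner_list_add algebra_simps)
qed simp

text \<open>Complementarity of the seeds as a polynomial identity: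
  \<open>A(z) A_rev(z) + B(z) B_rev(z)\<close> is the monomial \<open>2 s z^(s-1)\<close>, whose
  middle coefficient comes from shift 0.\<close>

lemma int_seeds_golay:
  "\<forall>(a, b)\<in>set int_seeds. list_add (list_conv a (rev a)) (list_conv b (rev b)) =
     replicate (length a - 1) 0 @ 2 * int (length a) # replicate (length a - 1) 0"
  by code_simp

section \<open>Finite tests that separate the seeds and the signs\<close>

definition first_run :: "int list \<Rightarrow> nat" where
  "first_run p = length (takeWhile (\<lambda>x. x = hd p) p)"

text \<open>Suppose \<open>p\<close> stretched by \<open>w\<close> equals \<open>q\<close> stretched
  by \<open>w'\<close> up to a sign. Equal first runs force
  \<open>w * first_run p = w' * first_run q\<close>, so index \<open>j\<close> of \<open>p\<close>
  meets index \<open>j * first_run q div first_run p\<close> of \<open>q\<close>. Multiplying by the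
  entry at 0 removes the unknown sign.\<close>

definition distinguishes :: "int list \<Rightarrow> int list \<Rightarrow> bool" where
  "distinguishes p q \<longleftrightarrow> (\<exists>j\<in>set [0..<length p].
     p ! j * p ! 0 \<noteq> q ! 0 * q ! (j * first_run q div first_run p mod length q))"

text \<open>Different run lengths are compared by sampling one sequence at the multiples of its own weight,
  so the test need not be symmetric in its two arguments.\<close>

lemma int_seeds_distinguished:
  "\<forall>(a, b)\<in>set int_seeds. \<forall>(a', b')\<in>set int_seeds. (a, b) = (a', b') \<or>
     distinguishes (map2 (*) a b) (map2 (*) a' b') \<or> distinguishes (map2 (*) a' b') (map2 (*) a b)"
  by code_simp

text \<open>The first sign change of the product sequence therefore falls within its first
  period.\<close>

lemma int_seeds_first_run:
  "\<forall>(a, b)\<in>set int_seeds. first_run (map2 (*) a b) \<in> {0<..<length a}"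
  by code_simp

text \<open>\<open>h\<close>, \<open>t\<close>, \<open>e\<close> and \<open>d\<close> are the
  discrepancies of two choices in the global sign, positional scaling, \<open>\<epsilon>\<close> and
  \<open>\<delta>\<close>. They act as independent sign patterns on the digit \<open>i\<close>. A
  seed of length 2 has only two digits and leaves room for just \<open>h\<close> and
  \<open>t\<close>, which is why its \<open>\<epsilon>\<close> and \<open>\<delta>\<close> are
  fixed.\<close>

lemma int_seeds_signs:
  "\<forall>(a, b)\<in>set int_seeds. \<forall>h\<in>{1, -1}. \<forall>t\<in>{1, -1}. \<forall>e\<in>{1, -1}. \<forall>d\<in>{True, False}.
     (length a = 2 \<longrightarrow> e = 1 \<and> \<not> d) \<longrightarrow>
     (\<forall>i\<in>set [0..<length a]. h * (if even i then 1 else t)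
        * (if a ! i = b ! (length a - 1 - i) then 1 else e) * (if d then a ! i * b ! i else 1) = 1) \<longrightarrow>
     h = 1 \<and> t = 1 \<and> e = 1 \<and> \<not> d"
  by code_simp

section \<open>Entries of the constructed arrays\<close>

lemma unsqueeze_snoc:
  "1 \<notin> set ds \<Longrightarrow> length ix = length ds \<Longrightarrow> unsqueeze (ds @ [1]) ix = ix @ [0]"
proof (induction ds arbitrary: ix)
  case (Cons d ds)
  then show ?case by (cases ix) auto
qed simp

definition lens :: "seed_choice list \<Rightarrow> nat list" where
  "lens cs = map (length \<circ> fst) cs"

lemma lens_simps [simp]:
  "lens [] = []" "lens (cs @ [(A, B, \<epsilon>, \<delta>)]) = lens cs @ [length A]" "length (lens cs) = length cs"
  by (auto simp: lens_def)

definition valid :: "seed_choice list \<Rightarrow> bool" where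
  "valid cs \<longleftrightarrow> set cs \<subseteq> (\<Union>s. seed_choices s)"

lemma valid_snoc: "valid (cs @ [ch]) \<longleftrightarrow> valid cs \<and> (\<exists>s. ch \<in> seed_choices s)"
  by (auto simp: valid_def)

abbreviation pm_one :: "complex \<Rightarrow> bool" where
  "pm_one z \<equiv> z \<in> {1, -1}"

lemma pm_one_mult: "pm_one x \<Longrightarrow> pm_one y \<Longrightarrow> pm_one (x * y)"
  by auto

lemma seed_choice_int:
  assumes "(A, B, \<epsilon>, \<delta>) \<in> seed_choices s"
  obtains a b where "(a, b) \<in> set int_seeds" "A = map of_int a" "B = map of_int b" "length a = s"
    "pm_one \<epsilon>" "pm_one \<delta>" "s = 2 \<longrightarrow> \<epsilon> = 1 \<and> \<delta> = 1"
proof -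
  have "(A, B) \<in> seed_pairs s" using assms by (simp add: seed_choices_def)
  then obtain a b where "(a, b) \<in> set int_seeds" "length a = s" "A = map of_int a" "B = map of_int b"
    using seed_pairs_int by blast
  then show ?thesis
    using assms by (intro that[of a b]) (auto simp: seed_choices_def split: if_splits)
qed

lemma seed_choice_basic:
  assumes "(A, B, \<epsilon>, \<delta>) \<in> seed_choices s"
  shows "length A = s" "length B = s" "2 \<le> s" "even s" "pm_one \<epsilon>" "pm_one \<delta>"
    and "i < s \<Longrightarrow> pm_one (A ! i)" "i < s \<Longrightarrow> pm_one (B ! i)"
    and "i < s \<Longrightarrow> A ! i * B ! i * (A ! (s - 1 - i) * B ! (s - 1 - i)) = -1"
proof -
  obtain a b where ab: "(a, b) \<in> set int_seeds" "A = map of_int a" "B = map of_int b" "length a = s"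
    "pm_one \<epsilon>" "pm_one \<delta>"
    using assms by (rule seed_choice_int)
  have b: "length b = s" "2 \<le> s" "even s" "\<forall>x\<in>set (a @ b). x = 1 \<or> x = -1"
    using int_seeds_basic ab(1,4) by auto
  show "length A = s" "length B = s" "2 \<le> s" "even s" "pm_one \<epsilon>" "pm_one \<delta>"
    using ab b by auto
  show "pm_one (A ! i)" if "i < s"
    using b(4) ab that by (auto dest: bspec[of _ _ "a ! i"])
  show "pm_one (B ! i)" if "i < s"
    using b ab that by (auto dest: bspec[of _ _ "b ! i"])
  show "A ! i * B ! i * (A ! (s - 1 - i) * B ! (s - 1 - i)) = -1" if "i < s"
  proof -
    have "a ! i * b ! i * (a ! (s - 1 - i) * b ! (s - 1 - i)) = -1"
      using int_seeds_skew ab(1,4) that by fastforce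
    then have "(of_int (a ! i * b ! i * (a ! (s - 1 - i) * b ! (s - 1 - i))) :: complex) = -1"
      by simp
    then show ?thesis using ab(2-4) b that by simp
  qed
qed

text \<open>\<open>coef\<close> is \<open>A'\<close> and \<open>same A B i\<close> says \<open>i \<in> S\<close> in the notation of the introduction.\<close>

definition coef :: "complex \<Rightarrow> complex list \<Rightarrow> complex list \<Rightarrow> nat \<Rightarrow> complex" where
  "coef \<delta> A B i = (if \<delta> = 1 then A ! i else B ! i)"

definition same :: "complex list \<Rightarrow> complex list \<Rightarrow> nat \<Rightarrow> bool" where
  "same A B i \<longleftrightarrow> A ! i = B ! (length A - 1 - i)"

lemma pm_one_coef:
  "(A, B, \<epsilon>, \<delta>) \<in> seed_choices s \<Longrightarrow> i < s \<Longrightarrow> pm_one (coef \<delta> A B i)"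
  using seed_choice_basic(7,8) by (simp only: coef_def split: if_splits) blast

text \<open>The condition at \<open>i\<close> is \<open>A[i] B[s-1-i] = 1\<close>, the one at
  \<open>s - 1 - i\<close> is \<open>A[s-1-i] B[i] = 1\<close>, and the product of the two left
  sides is -1.\<close>

lemma same_flip:
  assumes "(A, B, \<epsilon>, \<delta>) \<in> seed_choices s" "i < s"
  shows "same A B (s - 1 - i) \<longleftrightarrow> \<not> same A B i"
proof -
  have j: "s - 1 - i < s" "s - 1 - (s - 1 - i) = i" using assms(2) by auto
  show ?thesis
    using seed_choice_basic(1)[OF assms(1)] seed_choice_basic(7,8,9)[OF assms]
      seed_choice_basic(7,8)[OF assms(1) j(1)] j(2)
    by (auto simp: same_def)
qed

text \<open>With \<open>E = [1]\<close> and \<open>F = [\<delta>]\<close> these are the total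
  coefficients of \<open>C\<close> and \<open>D\<close> in \<open>opM\<close>. For each
  \<open>i\<close> exactly one of them survives, which is why every new entry is a signed copy of a
  single old one.\<close>

lemma seqPQ_values:
  assumes "(A, B, \<epsilon>, \<delta>) \<in> seed_choices s" "i < s"
  shows "seqP A B ! i + star (seqQ A B) ! i * \<delta> = (if same A B i then coef \<delta> A B i else 0)"
    and "seqQ A B ! i - star (seqP A B) ! i * \<delta> = (if same A B i then 0 else coef \<delta> A B i)"
proof -
  define x y u v where "x = A ! i" "y = B ! i" "u = A ! (s - 1 - i)" "v = B ! (s - 1 - i)"
  have j: "s - Suc i < s" "s - Suc (s - Suc i) = i" "s - 1 - i = s - Suc i" using assms(2) by auto
  have pm: "pm_one x" "pm_one y" "pm_one u" "pm_one v" "pm_one \<delta>"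
    using seed_choice_basic(6)[OF assms(1)] seed_choice_basic(7,8)[OF assms]
      seed_choice_basic(7,8)[OF assms(1) j(1)] by (simp_all only: x_y_u_v_def j)
  have prod: "x * y * (u * v) = -1"
    using seed_choice_basic(9)[OF assms] by (simp only: x_y_u_v_def)
  have len: "length A = s" "length B = s" using seed_choice_basic[OF assms(1)] by auto
  have P: "seqP A B ! i = (x + y + (v - u)) / 4" "seqQ A B ! i = (x + y - (v - u)) / 4"
    "star (seqP A B) ! i = (u + v + (y - x)) / 4" "star (seqQ A B) ! i = (u + v - (y - x)) / 4"
    using pm by (auto simp: seqP_def seqQ_def star_def rev_nth len j assms(2) x_y_u_v_def)
  have s: "same A B i \<longleftrightarrow> x = v" by (simp add: same_def len x_y_u_v_def)
  have c: "coef \<delta> A B i = (if \<delta> = 1 then x else y)" by (simp add: coef_def x_y_u_v_def)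
  show "seqP A B ! i + star (seqQ A B) ! i * \<delta> = (if same A B i then coef \<delta> A B i else 0)"
    "seqQ A B ! i - star (seqP A B) ! i * \<delta> = (if same A B i then 0 else coef \<delta> A B i)"
    unfolding P s c using pm prod by auto
qed

abbreviation G_of :: "seed_choice list \<Rightarrow> nat list \<Rightarrow> complex" where
  "G_of cs \<equiv> ent (fst (build cs))"

abbreviation K_of :: "seed_choice list \<Rightarrow> nat list \<Rightarrow> complex" where
  "K_of cs \<equiv> ent (snd (build cs))"

lemma lens_valid: "valid cs \<Longrightarrow> \<forall>d\<in>set (lens cs). 2 \<le> d"
proof (induction cs rule: rev_induct)
  case (snoc ch cs)
  obtain A B \<epsilon> \<delta> where ch: "ch = (A, B, \<epsilon>, \<delta>)" by (cases ch)
  with snoc show ?case by (auto simp: valid_snoc dest: seed_choice_basic(1,3))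
qed simp

lemma build_Nil: "dims (fst (build [])) = []" "dims (snd (build [])) = []" "G_of [] [] = 1" "K_of [] [] = 1"
  by (simp_all add: build_def squeeze_def array_of_seq_def)

lemma build_snoc: "build (cs @ [ch]) = build_step ch (build cs)"
  by (simp add: build_def)

text \<open>Every seed length is at least 2, so \<open>squeeze\<close> removes only the trailing
  dimension of size 1 contributed by \<open>E\<close> and \<open>F\<close>.\<close>

lemma dims_build:
  "valid cs \<Longrightarrow> dims (fst (build cs)) = lens cs \<and> dims (snd (build cs)) = lens cs"
proof (induction cs rule: rev_induct)
  case Nil
  then show ?case by (simp add: build_Nil)
next
  case (snoc ch cs)
  obtain A B \<epsilon> \<delta> where ch: "ch = (A, B, \<epsilon>, \<delta>)" by (cases ch)
  obtain G K where GK: "build cs = (G, K)" by (cases "build cs")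
  have IH: "dims G = lens cs" using snoc GK by (simp add: valid_snoc)
  have "\<forall>d\<in>set (lens (cs @ [ch])). 2 \<le> d" using lens_valid[OF snoc.prems] .
  then have "filter (\<lambda>d. d \<noteq> 1) (lens cs @ [length A]) = lens cs @ [length A]"
    unfolding ch by (intro filter_True) auto
  then show ?case
    by (auto simp: build_snoc GK ch build_step_def opM_def Let_def squeeze_def IH)
qed

text \<open>Conjugations are kept here, because the fact that all entries are signs is itself proved
  by induction from this recursion. \<open>build_snoc_entries\<close> removes them
  afterwards.\<close>

lemma build_snoc_raw:
  assumes "valid (cs @ [(A, B, \<epsilon>, \<delta>)])" "j \<in> box (lens cs)" "i < length A"
  shows "G_of (cs @ [(A, B, \<epsilon>, \<delta>)]) (j @ [i]) =
      (if same A B i then coef \<delta> A B i * G_of cs j else \<epsilon> * coef \<delta> A B i * K_of cs j)"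
    and "K_of (cs @ [(A, B, \<epsilon>, \<delta>)]) (j @ [i]) =
      (if same A B i then - \<epsilon> * coef \<delta> A B i * cnj (K_of cs (flip_index (lens cs) j))
       else coef \<delta> A B i * cnj (G_of cs (flip_index (lens cs) j)))"
proof -
  obtain s where ch: "(A, B, \<epsilon>, \<delta>) \<in> seed_choices s" using assms(1) by (auto simp: valid_snoc)
  note b = seed_choice_basic[OF ch]
  obtain G K where GK: "build cs = (G, K)" by (cases "build cs")
  have d: "dims G = lens cs" "dims K = lens cs"
    using dims_build[of cs] assms(1) GK by (auto simp: valid_snoc)
  have "\<forall>d\<in>set (lens cs @ [length A]). 2 \<le> d" using lens_valid[OF assms(1)] by simp
  then have one: "1 \<notin> set (lens cs @ [length A])" by fastforce
  have len: "length j = length cs" using assms(2) by (simp add: box_def)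
  have u: "unsqueeze (lens cs @ [length A, Suc 0]) (j @ [i]) = j @ [i, 0]"
    using unsqueeze_snoc[OF one, of "j @ [i]"] len by simp
  have i: "i < s" using assms(3) b by simp
  note PQ = seqPQ_values[OF ch i]
  \<comment> \<open>\<open>array_star\<close> is applied to the scaled array and hence also
    conjugates \<open>\<epsilon>\<close>.\<close>
  have c: "cnj \<epsilon> = \<epsilon>" using b(5) by auto
  show "G_of (cs @ [(A, B, \<epsilon>, \<delta>)]) (j @ [i]) =
      (if same A B i then coef \<delta> A B i * G_of cs j else \<epsilon> * coef \<delta> A B i * K_of cs j)"
  proof -
    have "G_of (cs @ [(A, B, \<epsilon>, \<delta>)]) (j @ [i]) =
      (seqP A B ! i + star (seqQ A B) ! i * \<delta>) * ent G j
      + \<epsilon> * (seqQ A B ! i - star (seqP A B) ! i * \<delta>) * ent K j"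
      by (simp add: build_snoc GK build_step_def opM_def Let_def squeeze_def d u len nth_append
        array_scale_def algebra_simps)
    then show ?thesis unfolding PQ GK by simp
  qed
  show "K_of (cs @ [(A, B, \<epsilon>, \<delta>)]) (j @ [i]) =
      (if same A B i then - \<epsilon> * coef \<delta> A B i * cnj (K_of cs (flip_index (lens cs) j))
       else coef \<delta> A B i * cnj (G_of cs (flip_index (lens cs) j)))"
  proof -
    have "K_of (cs @ [(A, B, \<epsilon>, \<delta>)]) (j @ [i]) =
      (seqQ A B ! i - star (seqP A B) ! i * \<delta>) * cnj (ent G (flip_index (lens cs) j))
      - \<epsilon> * (seqP A B ! i + star (seqQ A B) ! i * \<delta>) * cnj (ent K (flip_index (lens cs) j))"
      by (simp add: build_snoc GK build_step_def opM_def Let_def squeeze_def d u len nth_append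
        array_scale_def array_star_def flip_index_def c algebra_simps)
    then show ?thesis unfolding PQ GK by simp
  qed
qed

lemma build_pm_one:
  "valid cs \<Longrightarrow> ix \<in> box (lens cs) \<Longrightarrow> pm_one (G_of cs ix) \<and> pm_one (K_of cs ix)"
proof (induction cs arbitrary: ix rule: rev_induct)
  case Nil
  then show ?case by (simp add: box_Nil build_Nil)
next
  case (snoc ch cs)
  obtain A B \<epsilon> \<delta> where ch: "ch = (A, B, \<epsilon>, \<delta>)" by (cases ch)
  obtain s where s: "(A, B, \<epsilon>, \<delta>) \<in> seed_choices s" using snoc.prems(1) ch by (auto simp: valid_snoc)
  obtain j i where ix: "ix = j @ [i]" "j \<in> box (lens cs)" "i < length A"
    using snoc.prems(2) unfolding ch lens_simps by (rule in_box_snocE)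
  have v: "valid cs" using snoc.prems by (simp add: valid_snoc)
  have c: "pm_one (coef \<delta> A B i)" using pm_one_coef[OF s, of i] ix seed_choice_basic(1)[OF s] by blast
  have e: "pm_one \<epsilon>" using seed_choice_basic(5)[OF s] .
  note IH = snoc.IH[OF v ix(2)] snoc.IH[OF v flip_index_in_box[OF ix(2)]]
  show ?case
    unfolding ch ix(1) build_snoc_raw[OF snoc.prems(1)[unfolded ch] ix(2,3)]
    using IH c e by auto
qed

lemma build_snoc_entries:
  assumes "valid (cs @ [(A, B, \<epsilon>, \<delta>)])" "j \<in> box (lens cs)" "i < length A"
  shows "G_of (cs @ [(A, B, \<epsilon>, \<delta>)]) (j @ [i]) =
      (if same A B i then coef \<delta> A B i * G_of cs j else \<epsilon> * coef \<delta> A B i * K_of cs j)"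
    and "K_of (cs @ [(A, B, \<epsilon>, \<delta>)]) (j @ [i]) =
      (if same A B i then - \<epsilon> * coef \<delta> A B i * K_of cs (flip_index (lens cs) j)
       else coef \<delta> A B i * G_of cs (flip_index (lens cs) j))"
proof -
  have "valid cs" using assms(1) by (simp add: valid_snoc)
  from build_pm_one[OF this flip_index_in_box[OF assms(2)]]
  have "cnj (K_of cs (flip_index (lens cs) j)) = K_of cs (flip_index (lens cs) j)"
    "cnj (G_of cs (flip_index (lens cs) j)) = G_of cs (flip_index (lens cs) j)" by auto
  with build_snoc_raw[OF assms] show "G_of (cs @ [(A, B, \<epsilon>, \<delta>)]) (j @ [i]) =
      (if same A B i then coef \<delta> A B i * G_of cs j else \<epsilon> * coef \<delta> A B i * K_of cs j)"
    "K_of (cs @ [(A, B, \<epsilon>, \<delta>)]) (j @ [i]) =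
      (if same A B i then - \<epsilon> * coef \<delta> A B i * K_of cs (flip_index (lens cs) j)
       else coef \<delta> A B i * G_of cs (flip_index (lens cs) j))"
    by (simp_all only:)
qed

text \<open>Exactly one of \<open>i\<close> and \<open>s - 1 - i\<close> satisfies
  \<open>same\<close>, and the second flip undoes the first. Both factors therefore contain the same
  old entry, of \<open>G\<close> or of \<open>K\<close>, which squares to 1; only seed entries
  remain.\<close>

lemma build_times_flip:
  assumes "valid (cs @ [(A, B, \<epsilon>, \<delta>)])" "j \<in> box (lens cs)" "i < length A"
  shows "G_of (cs @ [(A, B, \<epsilon>, \<delta>)]) (j @ [i])
      * K_of (cs @ [(A, B, \<epsilon>, \<delta>)]) (flip_index (lens cs @ [length A]) (j @ [i])) = - \<delta> * (A ! i * B ! i)"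
proof -
  obtain s where ch: "(A, B, \<epsilon>, \<delta>) \<in> seed_choices s" using assms(1) by (auto simp: valid_snoc)
  note b = seed_choice_basic[OF ch]
  have i: "i < s" "s - 1 - i < s" "s - 1 - (s - 1 - i) = i" using assms(3) b(1,3) by auto
  have v: "valid cs" using assms(1) by (simp add: valid_snoc)
  have f: "flip_index (lens cs @ [length A]) (j @ [i]) = flip_index (lens cs) j @ [s - 1 - i]"
    using assms(2) b(1) by (simp add: flip_index_snoc box_def)
  note K = build_snoc_entries(2)[OF assms(1) flip_index_in_box[OF assms(2)], of "s - 1 - i", unfolded b(1), OF i(2)]
  have sf: "same A B (s - 1 - i) \<longleftrightarrow> \<not> same A B i" by (rule same_flip[OF ch i(1)])
  define x y u v g k where vars: "x = A ! i" "y = B ! i" "u = A ! (s - 1 - i)" "v = B ! (s - 1 - i)"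
    "g = G_of cs j" "k = K_of cs j"
  have same: "same A B i \<longleftrightarrow> x = v" by (simp add: same_def vars b(1))
  have c: "coef \<delta> A B i = (if \<delta> = 1 then x else y)" "coef \<delta> A B (s - 1 - i) = (if \<delta> = 1 then u else v)"
    by (simp_all add: coef_def vars)
  have pm: "pm_one x" "pm_one y" "pm_one u" "pm_one v" "pm_one g" "pm_one k"
    using build_pm_one[OF v assms(2)] b(7,8)[OF i(1)] b(7,8)[OF i(2)] by (simp_all only: vars)
  have prod: "x * y * (u * v) = -1" using b(9)[OF i(1)] by (simp only: vars)
  have gk: "g * g = 1" "k * k = 1" "\<epsilon> * \<epsilon> = 1" using pm b(5) by auto
  show ?thesis
  proof (cases "x = v")
    case True
    then have "G_of (cs @ [(A, B, \<epsilon>, \<delta>)]) (j @ [i])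
      * K_of (cs @ [(A, B, \<epsilon>, \<delta>)]) (flip_index (lens cs @ [length A]) (j @ [i]))
      = (if \<delta> = 1 then x * u else y * v) * (g * g)"
      unfolding f K build_snoc_entries(1)[OF assms] sf flip_flip_index[OF assms(2)] same c vars(5,6)[symmetric]
      by simp
    then show ?thesis using gk prod pm b(6) True by (auto simp: vars(1,2)[symmetric])
  next
    case False
    then have "G_of (cs @ [(A, B, \<epsilon>, \<delta>)]) (j @ [i])
      * K_of (cs @ [(A, B, \<epsilon>, \<delta>)]) (flip_index (lens cs @ [length A]) (j @ [i]))
      = - (if \<delta> = 1 then x * u else y * v) * (\<epsilon> * \<epsilon>) * (k * k)"
      unfolding f K build_snoc_entries(1)[OF assms] sf flip_flip_index[OF assms(2)] same c vars(5,6)[symmetric]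
      by simp
    then show ?thesis using gk prod pm b(6) False by (auto simp: vars(1,2)[symmetric])
  qed
qed

section \<open>Recovering the choices from the output\<close>

lemma first_run_constant: "j < first_run p \<Longrightarrow> p ! j = p ! 0"
proof -
  assume j: "j < first_run p"
  then have "takeWhile (\<lambda>x. x = hd p) p ! j \<in> set (takeWhile (\<lambda>x. x = hd p) p)"
    unfolding first_run_def by (rule nth_mem)
  then have "takeWhile (\<lambda>x. x = hd p) p ! j = hd p"
    by (drule_tac set_takeWhileD) simp
  moreover have "takeWhile (\<lambda>x. x = hd p) p ! j = p ! j"
    using j unfolding first_run_def by (rule takeWhile_nth)
  moreover have "p \<noteq> []" using j by (auto simp: first_run_def)
  ultimately show ?thesis by (simp add: hd_conv_nth)
qed

lemma first_run_changes: "first_run p < length p \<Longrightarrow> p ! first_run p \<noteq> p ! 0"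
  using nth_length_takeWhile[of "\<lambda>x. x = hd p" p] hd_conv_nth[of p] unfolding first_run_def
  by (cases "p = []") auto

text \<open>Otherwise \<open>p\<close> would change at \<open>t = w * first_run p\<close> while
  \<open>q\<close> is still in its first run. The bounds by \<open>n\<close> place this
  \<open>t\<close> inside the range of agreement.\<close>

lemma stretch_first_change_le:
  assumes "0 < w" "0 < w'" "first_run p < length p" "first_run q < length q"
    and "w * length p \<le> n" "w' * length q \<le> n"
    and agree: "\<forall>t<n. p ! (t div w mod length p) = c * q ! (t div w' mod length q)"
  shows "w' * first_run q \<le> w * first_run p"
proof (rule ccontr)
  assume "\<not> ?thesis"
  then have lt: "w * first_run p < w' * first_run q" by simp
  have "w * first_run p < w * length p" using assms(1,3) by simp
  then have n: "w * first_run p < n" using assms(5) by linarith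
  then have 0: "p ! 0 = c * q ! 0" using agree[rule_format, of 0] by simp
  have d: "w * first_run p div w' < first_run q"
    using lt by (simp add: less_mult_imp_div_less mult.commute)
  have "p ! first_run p = c * q ! (w * first_run p div w' mod length q)"
    using agree[rule_format, OF n] assms(1,3) by simp
  also have "\<dots> = c * q ! 0"
    using first_run_constant[OF d] d assms(4) by simp
  finally show False using 0 first_run_changes[OF assms(3)] by simp
qed

text \<open>Sample the agreement at \<open>t = w * j\<close> and at \<open>t = 0\<close>, and
  multiply the two equations; the common factor \<open>c\<close> disappears by
  \<open>c * c = 1\<close>.\<close>

lemma stretch_not_distinguished:
  assumes "0 < w" "0 < w'" "0 < first_run p" and "c * c = 1"
    and "w * length p \<le> n"
    and runs: "w * first_run p = w' * first_run q"
    and agree: "\<forall>t<n. p ! (t div w mod length p) = c * q ! (t div w' mod length q)"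
  shows "\<not> distinguishes p q"
proof
  assume "distinguishes p q"
  then obtain j where j: "j < length p"
    and ne: "p ! j * p ! 0 \<noteq> q ! 0 * q ! (j * first_run q div first_run p mod length q)"
    by (auto simp: distinguishes_def)
  have "w * j < w * length p" using j assms(1) by simp
  then have n: "w * j < n" using assms(5) by linarith
  have "w * j div w' = (w * j * first_run p) div (w' * first_run p)"
    using assms(3) by simp
  also have "w * j * first_run p = w' * (j * first_run q)"
    using runs by (simp add: algebra_simps)
  also have "w' * (j * first_run q) div (w' * first_run p) = j * first_run q div first_run p"
    using assms(2) by simp
  finally have "p ! j = c * q ! (j * first_run q div first_run p mod length q)"
    using agree[rule_format, OF n] assms(1) j by simp
  moreover have "p ! 0 = c * q ! 0" using agree[rule_format, of 0] n by simp
  ultimately have "p ! j * p ! 0 = (c * c) * (q ! 0 * q ! (j * first_run q div first_run p mod length q))"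
    by (simp add: algebra_simps)
  then show False using ne assms(4) by simp
qed

text \<open>Equality of the first change positions follows by applying the comparison in both
  directions. The finite test then identifies the seeds, and equal run lengths give equal
  weights.\<close>

lemma stretch_determines_seed:
  assumes seeds: "(a, b) \<in> set int_seeds" "(a', b') \<in> set int_seeds"
    and w: "0 < w" "0 < w'" and c: "c * c = 1"
    and n: "w * length a \<le> n" "w' * length a' \<le> n"
    and agree: "\<forall>t<n. a ! (t div w mod length a) * b ! (t div w mod length a)
      = c * (a' ! (t div w' mod length a') * b' ! (t div w' mod length a'))"
  shows "w = w' \<and> a = a' \<and> b = b'"
proof -
  define p q where "p = map2 (*) a b" and "q = map2 (*) a' b'"
  have len: "length b = length a" "length b' = length a'" "0 < length a" "0 < length a'"
    using bspec[OF int_seeds_basic seeds(1)] bspec[OF int_seeds_basic seeds(2)] by auto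
  have lp: "length p = length a" "length q = length a'" using len by (auto simp: p_def q_def)
  have r: "0 < first_run p" "first_run p < length p" "0 < first_run q" "first_run q < length q"
    using bspec[OF int_seeds_first_run seeds(1)] bspec[OF int_seeds_first_run seeds(2)] lp
    by (simp_all add: p_def q_def)
  have nth: "p ! (t mod length p) = a ! (t mod length a) * b ! (t mod length a)"
    "q ! (t mod length q) = a' ! (t mod length a') * b' ! (t mod length a')" for t
    using len by (auto simp: p_def q_def)
  have ag: "\<forall>t<n. p ! (t div w mod length p) = c * q ! (t div w' mod length q)"
    using agree by (simp add: nth)
  have ag': "\<forall>t<n. q ! (t div w' mod length q) = c * p ! (t div w mod length p)"
  proof clarify
    fix t assume "t < n"
    with ag have "c * p ! (t div w mod length p) = (c * c) * q ! (t div w' mod length q)" by simp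
    with c show "q ! (t div w' mod length q) = c * p ! (t div w mod length p)" by simp
  qed
  note n' = n[folded lp]
  have runs: "w * first_run p = w' * first_run q"
    using stretch_first_change_le[OF w r(2,4) n' ag]
      stretch_first_change_le[OF w(2,1) r(4,2) n'(2,1) ag'] by simp
  have "\<not> distinguishes p q" "\<not> distinguishes q p"
    using stretch_not_distinguished[OF w r(1) c n'(1) runs ag]
      stretch_not_distinguished[OF w(2,1) r(3) c n'(2) runs[symmetric] ag'] by auto
  then have "(a, b) = (a', b')"
    using bspec[OF bspec[OF int_seeds_distinguished seeds(1), unfolded prod.case] seeds(2)]
    by (simp add: p_def q_def)
  moreover from this have "w = w'" using runs r(1) by (simp add: p_def q_def)
  ultimately show ?thesis by simp
qed

text \<open>The factor of the slice of \<open>x\<close> at \<open>i\<close> relative to the previous pair; \<open>t\<close> tells whether the last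
  dimension is positionally scaled.\<close>

definition twist :: "complex \<Rightarrow> bool \<Rightarrow> complex \<Rightarrow> complex \<Rightarrow> complex list \<Rightarrow> complex list \<Rightarrow> nat \<Rightarrow> complex" where
  "twist \<eta> t \<epsilon> \<delta> A B i = \<eta> * (if t then (-1) ^ i else 1) * (if same A B i then 1 else \<epsilon>) * coef \<delta> A B i"

lemma pm_one_twist:
  assumes "(A, B, \<epsilon>, \<delta>) \<in> seed_choices s" "i < s" "pm_one \<eta>"
  shows "pm_one (twist \<eta> t \<epsilon> \<delta> A B i)"
proof -
  have "pm_one ((-1) ^ i)" by (cases "even i") auto
  then show ?thesis unfolding twist_def
    using assms(3) seed_choice_basic(5)[OF assms(1)] pm_one_coef[OF assms(1,2)]
    by (intro pm_one_mult) auto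
qed

text \<open>Twists are signs, so equal twists have product 1. This product splits into the
  discrepancy factors of \<open>int_seeds_signs\<close>.\<close>

lemma twist_determines_signs:
  assumes ch: "(A, B, \<epsilon>, \<delta>) \<in> seed_choices s" and ch': "(A, B, \<epsilon>', \<delta>') \<in> seed_choices s"
    and \<eta>: "pm_one \<eta>" "pm_one \<eta>'"
    and eq: "\<forall>i<s. twist \<eta> t \<epsilon> \<delta> A B i = twist \<eta>' t' \<epsilon>' \<delta>' A B i"
  shows "\<eta> = \<eta>' \<and> t = t' \<and> \<epsilon> = \<epsilon>' \<and> \<delta> = \<delta>'"
proof -
  obtain a b where ab: "(a, b) \<in> set int_seeds" "A = map of_int a" "B = map of_int b" "length a = s"
    and two: "s = 2 \<longrightarrow> \<epsilon> = 1 \<and> \<delta> = 1"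
    using ch by (rule seed_choice_int) blast
  have two': "s = 2 \<longrightarrow> \<epsilon>' = 1 \<and> \<delta>' = 1" using ch' by (rule seed_choice_int)
  have len: "length b = s" using bspec[OF int_seeds_basic ab(1)] ab(4) by simp
  note pm = \<eta> seed_choice_basic(5,6)[OF ch] seed_choice_basic(5,6)[OF ch']
  \<comment> \<open>Each integer is 1 if the two parameters agree and -1 otherwise, which is their
    product when they are signs.\<close>
  define h t0 e :: int where "h = (if \<eta> = \<eta>' then 1 else -1)" and "t0 = (if t = t' then 1 else -1)"
    and "e = (if \<epsilon> = \<epsilon>' then 1 else -1)"
  have "h * (if even i then 1 else t0) * (if a ! i = b ! (length a - 1 - i) then 1 else e)
      * (if \<delta> \<noteq> \<delta>' then a ! i * b ! i else 1) = 1" if i: "i < s" for i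
  proof -
    have s: "same A B i \<longleftrightarrow> a ! i = b ! (length a - 1 - i)"
      using i len by (simp add: same_def ab)
    have AB: "A ! i = of_int (a ! i)" "B ! i = of_int (b ! i)" using i len by (simp_all add: ab)
    have "pm_one (twist \<eta> t \<epsilon> \<delta> A B i)" by (rule pm_one_twist[OF ch i \<eta>(1)])
    then have "twist \<eta> t \<epsilon> \<delta> A B i * twist \<eta>' t' \<epsilon>' \<delta>' A B i = 1"
      using eq i by auto
    also have "twist \<eta> t \<epsilon> \<delta> A B i * twist \<eta>' t' \<epsilon>' \<delta>' A B i =
      (\<eta> * \<eta>') * ((if t then (-1) ^ i else 1) * (if t' then (-1) ^ i else 1))
      * ((if same A B i then 1 else \<epsilon>) * (if same A B i then 1 else \<epsilon>'))
      * (coef \<delta> A B i * coef \<delta>' A B i)"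
      by (simp add: twist_def mult_ac)
    also have "\<eta> * \<eta>' = of_int h" using pm by (auto simp: h_def)
    also have "(if t then (-1) ^ i else 1) * (if t' then (-1) ^ i else 1)
        = (of_int (if even i then 1 else t0) :: complex)"
      by (auto simp: t0_def)
    also have "(if same A B i then 1 else \<epsilon>) * (if same A B i then 1 else \<epsilon>')
        = of_int (if a ! i = b ! (length a - 1 - i) then 1 else e)"
      unfolding s using pm by (auto simp: e_def)
    also have "coef \<delta> A B i * coef \<delta>' A B i = of_int (if \<delta> \<noteq> \<delta>' then a ! i * b ! i else 1)"
      using pm seed_choice_basic(7,8)[OF ch i] AB by (auto simp: coef_def)
    finally have "(of_int (h * (if even i then 1 else t0) * (if a ! i = b ! (length a - 1 - i) then 1 else e)
      * (if \<delta> \<noteq> \<delta>' then a ! i * b ! i else 1)) :: complex) = of_int 1"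
      by (simp only: of_int_mult of_int_1)
    then show ?thesis by (simp only: of_int_eq_iff)
  qed
  then have all: "\<forall>i\<in>set [0..<length a]. h * (if even i then 1 else t0)
      * (if a ! i = b ! (length a - 1 - i) then 1 else e) * (if \<delta> \<noteq> \<delta>' then a ! i * b ! i else 1) = 1"
    using ab(4) by (simp)
  have sg: "h \<in> {1, -1}" "t0 \<in> {1, -1}" "e \<in> {1, -1}" "(\<delta> \<noteq> \<delta>') \<in> {True, False}"
    by (simp_all add: h_def t0_def e_def)
  have l2: "length a = 2 \<longrightarrow> e = 1 \<and> \<not> \<delta> \<noteq> \<delta>'"
    using two two' ab(4) by (auto simp: e_def)
  have "h = 1 \<and> t0 = 1 \<and> e = 1 \<and> \<not> \<delta> \<noteq> \<delta>'"
    by (rule mp[OF mp[OF bspec[OF bspec[OF bspec[OF bspec[OF bspec[OF int_seeds_signs ab(1),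
      unfolded prod.case] sg(1)] sg(2)] sg(3)] sg(4)] l2] all])
  then show ?thesis by (auto simp: h_def t0_def e_def split: if_splits)
qed

section \<open>Peeling off the last dimension of an output\<close>

definition scaled :: "nat set \<Rightarrow> complex \<Rightarrow> (nat list \<Rightarrow> complex) \<Rightarrow> nat list \<Rightarrow> complex" where
  "scaled T \<eta> g ix = (\<Prod>k\<in>T. (-1) ^ (ix ! k)) * (\<eta> * g ix)"

lemma pm_one_prod_signs: "finite T \<Longrightarrow> pm_one (\<Prod>k\<in>T. (-1) ^ f k)"
proof (induction T rule: finite_induct)
  case (insert x F)
  have "pm_one ((-1) ^ f x)" by (cases "even (f x)") auto
  with insert show ?case by (simp del: insert_iff add: pm_one_mult)
qed simp

text \<open>On a slice the positional sign of the last dimension is constant and can be absorbed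
  into the global sign.\<close>

lemma scaled_snoc:
  assumes "T \<subseteq> {..<Suc r}" "length j = r"
  shows "scaled T \<eta> g (j @ [i]) =
    scaled (T - {r}) (\<eta> * (if r \<in> T then (-1) ^ i else 1)) (\<lambda>j. g (j @ [i])) j"
proof -
  have fin: "finite T" using assms(1) finite_subset by blast
  have "(\<Prod>k\<in>T - {r}. (-1) ^ ((j @ [i]) ! k)) = (\<Prod>k\<in>T - {r}. (-1) ^ (j ! k) :: complex)"
    using assms by (intro prod.cong) (auto simp: nth_append)
  moreover have "(\<Prod>k\<in>T. (-1) ^ ((j @ [i]) ! k)) =
      (if r \<in> T then (-1) ^ i else 1) * (\<Prod>k\<in>T - {r}. (-1) ^ ((j @ [i]) ! k) :: complex)"
    using fin assms(2) by (auto simp: prod.remove nth_append)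
  ultimately show ?thesis by (simp add: scaled_def mult_ac)
qed

text \<open>A slice of \<open>x\<close> alone already shows the previous \<open>G\<close> or the
  previous \<open>K\<close>, depending on \<open>same\<close>. Both arrays of the previous step are
  thus visible in \<open>x\<close>.\<close>

lemma outer_slices:
  assumes v: "valid (cs @ [(A, B, \<epsilon>, \<delta>)])"
    and \<pi>: "perm_list (\<pi>1 @ \<pi>2) (length cs)"
    and T: "T \<subseteq> {..<Suc (length cs)}"
    and x: "represents (lens cs @ [length A]) (\<pi>1 @ length cs # \<pi>2)
      (scaled T \<eta> (G_of (cs @ [(A, B, \<epsilon>, \<delta>)]))) x"
    and i: "i < length A"
  shows "represents (lens cs) (\<pi>1 @ \<pi>2)
    (scaled (T - {length cs}) (twist \<eta> (length cs \<in> T) \<epsilon> \<delta> A B i) (if same A B i then G_of cs else K_of cs))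
    (slice (prod_list (map ((!) (lens cs)) \<pi>1)) (length A) (prod_list (lens cs)) i x)"
proof -
  have "represents (lens cs) (\<pi>1 @ \<pi>2)
    (\<lambda>j. scaled T \<eta> (G_of (cs @ [(A, B, \<epsilon>, \<delta>)])) (j @ [i]))
    (slice (prod_list (map ((!) (lens cs)) \<pi>1)) (length A) (prod_list (lens cs)) i x)"
    using represents_slice[of \<pi>1 \<pi>2 "lens cs" "length A" _ x i] \<pi> x i by simp
  moreover have "scaled T \<eta> (G_of (cs @ [(A, B, \<epsilon>, \<delta>)])) (j @ [i]) =
    scaled (T - {length cs}) (twist \<eta> (length cs \<in> T) \<epsilon> \<delta> A B i) (if same A B i then G_of cs else K_of cs) j"
    if j: "j \<in> box (lens cs)" for j
  proof -
    have l: "length j = length cs" using j by (simp add: box_def)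
    show ?thesis
      unfolding scaled_snoc[OF T l]
      unfolding scaled_def build_snoc_entries(1)[OF v j i] twist_def
      by (simp add: mult_ac)
  qed
  ultimately show ?thesis by (simp add: represents_def)
qed

text \<open>Pairing \<open>p\<close> with \<open>length x - 1 - p\<close> pairs an index with its
  flip, so \<open>build_times_flip\<close> applies and only the digit of the last dimension, read
  off at weight \<open>w\<close>, matters.\<close>

lemma outer_digit:
  assumes v: "valid (cs @ [(A, B, \<epsilon>, \<delta>)])"
    and \<pi>: "perm_list (\<pi>1 @ \<pi>2) (length cs)" "perm_list (\<pi>1 @ length cs # \<pi>2) (Suc (length cs))"
    and T: "T \<subseteq> {..<Suc (length cs)}"
    and pm: "pm_one \<eta>" "pm_one \<kappa>"
    and x: "represents (lens cs @ [length A]) (\<pi>1 @ length cs # \<pi>2)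
      (scaled T \<eta> (G_of (cs @ [(A, B, \<epsilon>, \<delta>)]))) x"
    and y: "represents (lens cs @ [length A]) (\<pi>1 @ length cs # \<pi>2)
      (scaled T \<kappa> (K_of (cs @ [(A, B, \<epsilon>, \<delta>)]))) y"
  defines "w \<equiv> prod_list (map ((!) (lens cs)) \<pi>1)"
  shows "0 < w" "w * length A \<le> length x"
    and "\<exists>c. pm_one c \<and> (\<forall>p<length x. x ! p * y ! (length x - 1 - p) =
      c * (A ! (p div w mod length A) * B ! (p div w mod length A)))"
proof -
  obtain s where ch: "(A, B, \<epsilon>, \<delta>) \<in> seed_choices s" using v by (auto simp: valid_snoc)
  note b = seed_choice_basic[OF ch]
  define ds where "ds = lens cs @ [length A]"
  have ge2: "\<forall>d\<in>set ds. 2 \<le> d" using lens_valid[OF v] by (simp add: ds_def)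
  have pi: "perm_list (\<pi>1 @ length cs # \<pi>2) (length ds)" using \<pi>(2) by (simp add: ds_def)
  have nx: "length x = prod_list ds" using x by (simp add: represents_def ds_def)
  have pos: "0 < prod_list (lens cs)"
    using ge2 by (intro gr0I) (fastforce simp: ds_def prod_list_zero_iff)
  have wm: "w * prod_list (map ((!) (lens cs)) \<pi>2) = prod_list (lens cs)"
    using prod_list_map_perm[of "\<pi>1 @ \<pi>2" "lens cs"] \<pi>(1) by (simp add: w_def)
  show w0: "0 < w" using wm pos by (metis mult_is_0 neq0_conv)
  have "w \<le> prod_list (lens cs)" using wm pos dvd_imp_le dvd_triv_left by metis
  then show "w * length A \<le> length x" by (simp add: nx ds_def)
  have finT: "finite T" using T finite_subset by blast
  \<comment> \<open>The positional signs at an index and at its flip multiply to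
    \<open>(-1) ^ (ds ! k - 1)\<close> in each scaled dimension, independently of the index.\<close>
  define c where "c = (\<Prod>k\<in>T. (-1) ^ (ds ! k - 1)) * (\<eta> * \<kappa> * - \<delta>)"
  have "pm_one c"
    unfolding c_def using pm b(6) by (intro pm_one_mult pm_one_prod_signs finT) auto
  moreover have "x ! p * y ! (length x - 1 - p) =
      c * (A ! (p div w mod length A) * B ! (p div w mod length A))" if p: "p < length x" for p
  proof -
    obtain ix where ix: "ix \<in> box ds" "pos ds (\<pi>1 @ length cs # \<pi>2) ix = p"
      by (rule pos_surj[OF pi p[unfolded nx]])
    from this(1) obtain j i where ji: "ix = j @ [i]" "j \<in> box (lens cs)" "i < length A"
      unfolding ds_def by (rule in_box_snocE)
    have "p = expand w (length A) i (pos (lens cs) (\<pi>1 @ \<pi>2) j)"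
      using pos_snoc[of \<pi>1 \<pi>2 "lens cs" j "length A" i] \<pi>(1) ji(2) ix(2)
      unfolding ji(1) ds_def w_def by simp
    then have digit: "p div w mod length A = i" using digit_expand[OF w0 ji(3)] by simp
    have X: "x ! p = scaled T \<eta> (G_of (cs @ [(A, B, \<epsilon>, \<delta>)])) ix"
      using x ix by (auto simp: represents_def ds_def)
    have "pos ds (\<pi>1 @ length cs # \<pi>2) (flip_index ds ix) = length x - 1 - p"
      using pos_flip[OF pi ix(1)] ix(2) nx by simp
    then have Y: "y ! (length x - 1 - p) = scaled T \<kappa> (K_of (cs @ [(A, B, \<epsilon>, \<delta>)])) (flip_index ds ix)"
      using y flip_index_in_box[OF ix(1)] by (auto simp: represents_def ds_def)
    have "(\<Prod>k\<in>T. (-1) ^ (ix ! k)) * (\<Prod>k\<in>T. (-1) ^ (flip_index ds ix ! k))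
        = (\<Prod>k\<in>T. (-1) ^ (ds ! k - 1) :: complex)"
      unfolding prod.distrib[symmetric]
    proof (rule prod.cong)
      fix k assume "k \<in> T"
      then have k: "k < length ds" using T by (auto simp: ds_def)
      then have "ix ! k + flip_index ds ix ! k = ds ! k - 1"
        using ix(1) by (auto simp: box_def flip_index_def)
      then show "(-1) ^ (ix ! k) * (-1) ^ (flip_index ds ix ! k) = ((-1) ^ (ds ! k - 1) :: complex)"
        by (metis power_add)
    qed simp
    moreover have "G_of (cs @ [(A, B, \<epsilon>, \<delta>)]) ix * K_of (cs @ [(A, B, \<epsilon>, \<delta>)]) (flip_index ds ix)
        = - \<delta> * (A ! i * B ! i)"
      unfolding ji(1) ds_def by (rule build_times_flip[OF v ji(2,3)])
    moreover have "x ! p * y ! (length x - 1 - p) =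
      ((\<Prod>k\<in>T. (-1) ^ (ix ! k)) * (\<Prod>k\<in>T. (-1) ^ (flip_index ds ix ! k))) * (\<eta> * \<kappa>)
      * (G_of (cs @ [(A, B, \<epsilon>, \<delta>)]) ix * K_of (cs @ [(A, B, \<epsilon>, \<delta>)]) (flip_index ds ix))"
      unfolding X Y scaled_def by (simp only: mult_ac)
    ultimately show ?thesis unfolding digit c_def by (simp only: mult_ac)
  qed
  ultimately show "\<exists>c. pm_one c \<and> (\<forall>p<length x. x ! p * y ! (length x - 1 - p) =
      c * (A ! (p div w mod length A) * B ! (p div w mod length A)))" by blast
qed

lemma scaled_cancel:
  assumes "finite T" "pm_one (g ix)" "scaled T \<eta> g ix = scaled T \<eta>' g ix"
  shows "\<eta> = \<eta>'"
proof -
  have "pm_one (\<Prod>k\<in>T. (-1) ^ (ix ! k))" by (rule pm_one_prod_signs[OF assms(1)])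
  with assms(2,3) show ?thesis by (auto simp: scaled_def)
qed

text \<open>Induction on the last step, with all data of the second construction arbitrary,
  including its number of seeds. The signs \<open>\<eta>\<close> and \<open>\<kappa>\<close> are
  independent because in the induction two slices of \<open>x\<close>, with unrelated signs, take
  the roles of \<open>x\<close> and \<open>y\<close>.\<close>

theorem build_injective:
  assumes "valid cs" "valid cs'"
    and "perm_list \<pi> (length cs)" "perm_list \<pi>' (length cs')"
    and "T \<subseteq> {..<length cs}" "T' \<subseteq> {..<length cs'}"
    and "pm_one \<eta>" "pm_one \<kappa>" "pm_one \<eta>'" "pm_one \<kappa>'"
    and "represents (lens cs) \<pi> (scaled T \<eta> (G_of cs)) x"
    and "represents (lens cs) \<pi> (scaled T \<kappa> (K_of cs)) y"
    and "represents (lens cs') \<pi>' (scaled T' \<eta>' (G_of cs')) x"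
    and "represents (lens cs') \<pi>' (scaled T' \<kappa>' (K_of cs')) y"
  shows "cs = cs' \<and> \<pi> = \<pi>' \<and> T = T' \<and> \<eta> = \<eta>' \<and> \<kappa> = \<kappa>'"
  using assms
proof (induction cs arbitrary: cs' \<pi> \<pi>' T T' \<eta> \<kappa> \<eta>' \<kappa>' x y rule: rev_induct)
  case Nil
  \<comment> \<open>The empty construction gives length 1, whereas any seed contributes a factor of
    at least 2.\<close>
  have len: "prod_list (lens cs') = 1"
    using Nil.prems(11,13) by (simp add: represents_def)
  have "cs' = []"
  proof (cases cs' rule: rev_cases)
    case (snoc cs ch)
    have "length (fst ch) \<in> set (lens cs')" by (simp add: snoc lens_def)
    then have "2 \<le> length (fst ch)" using lens_valid[OF Nil.prems(2)] by blast
    moreover have "length (fst ch) dvd prod_list (lens cs')" by (simp add: snoc lens_def)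
    ultimately show ?thesis using len by simp
  qed
  with Nil.prems show ?case
    by (auto simp: perm_list_def represents_def box_Nil scaled_def build_Nil)
next
  case (snoc ch cs)
  note prems = snoc.prems
  obtain A B \<epsilon> \<delta> where ch: "ch = (A, B, \<epsilon>, \<delta>)" by (cases ch)
  note v = prems(1)[unfolded ch]
  have "cs' \<noteq> []"
  proof
    assume "cs' = []"
    then have "prod_list (lens (cs @ [ch])) = 1"
      using prems(11,13) by (simp add: represents_def)
    moreover have "length A dvd prod_list (lens (cs @ [ch]))" by (simp add: ch)
    moreover have "2 \<le> length A" using lens_valid[OF prems(1)] by (simp add: ch)
    ultimately show False by simp
  qed
  then obtain cs0 ch' where cs': "cs' = cs0 @ [ch']" by (cases cs' rule: rev_cases) auto
  obtain A' B' \<epsilon>' \<delta>' where ch': "ch' = (A', B', \<epsilon>', \<delta>')" by (cases ch')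
  note v' = prems(2)[unfolded cs' ch']
  obtain s where seed: "(A, B, \<epsilon>, \<delta>) \<in> seed_choices s" using v by (auto simp: valid_snoc)
  obtain s' where seed': "(A', B', \<epsilon>', \<delta>') \<in> seed_choices s'" using v' by (auto simp: valid_snoc)
  have \<pi>Suc: "perm_list \<pi> (Suc (length cs))" "perm_list \<pi>' (Suc (length cs0))"
    using prems(3,4) by (simp_all add: cs')
  obtain \<pi>1 \<pi>2 where \<pi>: "\<pi> = \<pi>1 @ length cs # \<pi>2" "perm_list (\<pi>1 @ \<pi>2) (length cs)"
    by (rule perm_list_snocE[OF \<pi>Suc(1)])
  obtain \<pi>1' \<pi>2' where \<pi>': "\<pi>' = \<pi>1' @ length cs0 # \<pi>2'" "perm_list (\<pi>1' @ \<pi>2') (length cs0)"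
    by (rule perm_list_snocE[OF \<pi>Suc(2)])
  have pl: "perm_list (\<pi>1 @ length cs # \<pi>2) (Suc (length cs))"
    "perm_list (\<pi>1' @ length cs0 # \<pi>2') (Suc (length cs0))"
    using prems(3,4) by (simp_all add: \<pi> \<pi>' cs')
  have T: "T \<subseteq> {..<Suc (length cs)}" "T' \<subseteq> {..<Suc (length cs0)}" using prems(5,6) by (simp_all add: cs')
  note x = prems(11)[unfolded ch lens_simps \<pi>(1)] and y = prems(12)[unfolded ch lens_simps \<pi>(1)]
  note x' = prems(13)[unfolded cs' ch' lens_simps \<pi>'(1)] and y' = prems(14)[unfolded cs' ch' lens_simps \<pi>'(1)]
  define w where "w = prod_list (map ((!) (lens cs)) \<pi>1)"
  define w' where "w' = prod_list (map ((!) (lens cs0)) \<pi>1')"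
  obtain c where c: "pm_one c" "\<forall>p<length x. x ! p * y ! (length x - 1 - p) =
      c * (A ! (p div w mod length A) * B ! (p div w mod length A))"
    using outer_digit(3)[OF v \<pi>(2) pl(1) T(1) prems(7,8) x y] by (auto simp: w_def)
  obtain c' where c': "pm_one c'" "\<forall>p<length x. x ! p * y ! (length x - 1 - p) =
      c' * (A' ! (p div w' mod length A') * B' ! (p div w' mod length A'))"
    using outer_digit(3)[OF v' \<pi>'(2) pl(2) T(2) prems(9,10) x' y'] by (auto simp: w'_def)
  note od = outer_digit(1,2)[OF v \<pi>(2) pl(1) T(1) prems(7,8) x y, folded w_def]
  note od' = outer_digit(1,2)[OF v' \<pi>'(2) pl(2) T(2) prems(9,10) x' y', folded w'_def]
  obtain a b where ab: "(a, b) \<in> set int_seeds" "A = map of_int a" "B = map of_int b" "length a = s"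
    using seed by (rule seed_choice_int) blast
  obtain a' b' where ab': "(a', b') \<in> set int_seeds" "A' = map of_int a'" "B' = map of_int b'" "length a' = s'"
    using seed' by (rule seed_choice_int) blast
  note bs = seed_choice_basic[OF seed] and bs' = seed_choice_basic[OF seed']
  have lb: "length b = s" "length b' = s'" using bs(2) bs'(2) ab ab' by auto
  \<comment> \<open>\<open>e\<close> is the product of \<open>c\<close> and \<open>c'\<close>, as an
    integer, so that the comparison can be transferred to the integer seeds.\<close>
  define e :: int where "e = (if c = c' then 1 else -1)"
  have "a ! (t div w mod length a) * b ! (t div w mod length a)
      = e * (a' ! (t div w' mod length a') * b' ! (t div w' mod length a'))" if t: "t < length x" for t
  proof -
    have i: "t div w mod s < s" "t div w' mod s' < s'" using bs(3) bs'(3) by auto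
    define P Q where "P = a ! (t div w mod s) * b ! (t div w mod s)"
      and "Q = a' ! (t div w' mod s') * b' ! (t div w' mod s')"
    have "c * of_int P = c' * of_int Q"
      using c(2) c'(2) t i bs(1) bs'(1) lb ab(2-4) ab'(2-4) by (simp add: P_def Q_def)
    then have "(c * c) * of_int P = (c * c') * of_int Q" by (simp only: mult.assoc)
    moreover have "c * c = 1" "c * c' = of_int e" using c(1) c'(1) by (auto simp: e_def)
    ultimately have "of_int P = (of_int (e * Q) :: complex)" by simp
    then have "P = e * Q" by (simp only: of_int_eq_iff)
    then show ?thesis by (simp add: P_def Q_def ab(4) ab'(4))
  qed
  moreover have "e * e = 1" by (simp add: e_def)
  ultimately have "w = w' \<and> a = a' \<and> b = b'"
    using od od' bs(1) bs'(1) ab(4) ab'(4)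
    by (intro stretch_determines_seed[OF ab(1) ab'(1), of w w' e "length x"]) auto
  then have ww: "w = w'" and AB: "A' = A" "B' = B" using ab ab' by auto
  have ss: "s' = s" using bs(1) bs'(1) AB by simp
  \<comment> \<open>Both constructions must cut \<open>x\<close> into the same slices
    \<open>S i\<close>, so the slice lengths have to agree as well as the weights.\<close>
  have m: "prod_list (lens cs) = prod_list (lens cs0)"
    using x x' bs(1,3) by (simp add: represents_def AB)
  define S where "S i = slice w (length A) (prod_list (lens cs)) i x" for i
  define \<tau> where "\<tau> = twist \<eta> (length cs \<in> T) \<epsilon> \<delta> A B"
  define \<tau>' where "\<tau>' = twist \<eta>' (length cs0 \<in> T') \<epsilon>' \<delta>' A B"
  have rep: "represents (lens cs) (\<pi>1 @ \<pi>2)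
      (scaled (T - {length cs}) (\<tau> i) (if same A B i then G_of cs else K_of cs)) (S i)" if "i < s" for i
    using outer_slices[OF v \<pi>(2) T(1) x, of i] that bs(1) by (simp only: S_def w_def \<tau>_def)
  have rep': "represents (lens cs0) (\<pi>1' @ \<pi>2')
      (scaled (T' - {length cs0}) (\<tau>' i) (if same A B i then G_of cs0 else K_of cs0)) (S i)" if "i < s" for i
    using outer_slices[OF v' \<pi>'(2) T(2) x', of i, folded w'_def] that bs(1)
    by (simp only: S_def ww m \<tau>'_def AB)
  obtain i1 i2 where i: "i1 < s" "i2 < s" "same A B i1" "\<not> same A B i2"
  proof (cases "same A B 0")
    case True
    then show ?thesis using that[of 0 "s - 1"] same_flip[OF seed, of 0] bs(3) by simp
  next
    case False
    then show ?thesis using that[of "s - 1" 0] same_flip[OF seed, of 0] bs(3) by simp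
  qed
  \<comment> \<open>The twists at \<open>i1\<close> and \<open>i2\<close> serve as the two global
    signs in the induction hypothesis.\<close>
  have pm\<tau>: "pm_one (\<tau> i)" "pm_one (\<tau>' i)" if "i < s" for i
    unfolding \<tau>_def \<tau>'_def
    using pm_one_twist[OF seed that prems(7)] pm_one_twist[OF seed'[unfolded AB ss] that prems(9)] by auto
  have vcs: "valid cs" "valid cs0" using v v' by (simp_all add: valid_snoc)
  have T0: "T - {length cs} \<subseteq> {..<length cs}" "T' - {length cs0} \<subseteq> {..<length cs0}"
    using T by auto
  have IH: "cs = cs0 \<and> \<pi>1 @ \<pi>2 = \<pi>1' @ \<pi>2' \<and> T - {length cs} = T' - {length cs0} \<and> \<tau> i1 = \<tau>' i1 \<and> \<tau> i2 = \<tau>' i2"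
    using rep[OF i(1)] rep[OF i(2)] rep'[OF i(1)] rep'[OF i(2)] i(3,4)
    by (intro snoc.IH[OF vcs \<pi>(2) \<pi>'(2) T0 pm\<tau>(1)[OF i(1)] pm\<tau>(1)[OF i(2)] pm\<tau>(2)[OF i(1)] pm\<tau>(2)[OF i(2)],
      of "S i1" "S i2"]) simp_all
  then have cs0: "cs0 = cs" by simp
  have "\<forall>k\<in>set (\<pi>1 @ \<pi>2). 2 \<le> lens cs ! k"
    using \<pi>(2) lens_valid[OF vcs(1)] unfolding perm_list_def by auto
  then have "\<pi>1 = \<pi>1'"
    using insertion_point_unique[of \<pi>1 \<pi>2 \<pi>1' \<pi>2' "(!) (lens cs)"] IH ww by (simp add: w_def w'_def)
  with IH have pi: "\<pi> = \<pi>'" by (simp add: \<pi>(1) \<pi>'(1))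
  define z where "z = map (\<lambda>_. 0 :: nat) (lens cs)"
  have z: "z \<in> box (lens cs)"
    unfolding z_def using lens_valid[OF vcs(1)] by (intro zeros_in_box) force
  have fin: "finite T" "finite (T - {length cs})" using T finite_subset by blast+
  \<comment> \<open>The induction hypothesis gives this only at \<open>i1\<close> and
    \<open>i2\<close>. Now that the earlier data coincide, a single entry of each slice determines
    its twist.\<close>
  have "\<tau> i = \<tau>' i" if "i < s" for i
  proof (rule scaled_cancel[OF fin(2)])
    show "pm_one ((if same A B i then G_of cs else K_of cs) z)"
      using build_pm_one[OF vcs(1) z] by simp
    show "scaled (T - {length cs}) (\<tau> i) (if same A B i then G_of cs else K_of cs) z =
        scaled (T - {length cs}) (\<tau>' i) (if same A B i then G_of cs else K_of cs) z"
      using rep[OF that] rep'[OF that] IH z unfolding represents_def cs0 by metis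
  qed
  then have signs: "\<eta> = \<eta>' \<and> (length cs \<in> T \<longleftrightarrow> length cs \<in> T') \<and> \<epsilon> = \<epsilon>' \<and> \<delta> = \<delta>'"
    unfolding \<tau>_def \<tau>'_def cs0
    using twist_determines_signs[OF seed seed'[unfolded AB ss] prems(7,9)] by blast
  then have TT: "T = T'" using IH unfolding cs0 by blast
  have csch: "cs' = cs @ [ch]" using cs' ch ch' cs0 AB signs by simp
  \<comment> \<open>The slices of \<open>x\<close> carry no information on \<open>\<kappa>\<close>;
    it is read off from one entry of \<open>y\<close>.\<close>
  have "z @ [0] \<in> box (lens (cs @ [ch]))" using z bs(1,3) by (simp add: ch snoc_in_box)
  moreover from this have "scaled T \<kappa> (K_of (cs @ [ch])) (z @ [0]) = scaled T \<kappa>' (K_of (cs @ [ch])) (z @ [0])"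
    using prems(12,14) unfolding csch TT pi represents_def by metis
  ultimately have "\<kappa> = \<kappa>'"
    using scaled_cancel[OF fin(1), of "K_of (cs @ [ch])" "z @ [0]"] build_pm_one[OF prems(1)] by blast
  with pi TT signs csch show ?case by simp
qed

section \<open>Complementarity\<close>

lemma unit_cnj: "norm (z :: complex) = 1 \<Longrightarrow> z * cnj z = 1"
  by (simp add: complex_norm_square[symmetric])

lemma unit_power_flip:
  assumes "norm (z :: complex) = 1" "i < s"
  shows "z ^ (s - 1 - i) = z ^ (s - 1) * cnj (z ^ i)"
proof -
  have "z ^ i * cnj (z ^ i) = 1" using assms(1) by (intro unit_cnj) (simp add: norm_power)
  moreover have "z ^ (s - 1) = z ^ (s - 1 - i) * z ^ i"
    using assms(2) by (simp flip: power_add)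
  ultimately show ?thesis by (simp add: mult.assoc)
qed

text \<open>On the unit circle conjugation inverts \<open>z\<close>, so reversing real coefficients
  conjugates the value up to the unimodular factor \<open>z ^ (s - 1)\<close>.\<close>

lemma sum_flip_unit:
  fixes f :: "nat \<Rightarrow> complex"
  assumes z: "norm (z :: complex) = 1" and real: "\<And>i. i < s \<Longrightarrow> cnj (f i) = f i"
  shows "(\<Sum>i<s. f (s - 1 - i) * z ^ i) = z ^ (s - 1) * cnj (\<Sum>i<s. f i * z ^ i)"
proof -
  have "(\<Sum>i<s. f (s - 1 - i) * z ^ i) = (\<Sum>i<s. f i * z ^ (s - 1 - i))"
    by (subst sum.nat_diff_reindex[symmetric]) (auto intro!: sum.cong)
  also have "\<dots> = (\<Sum>i<s. z ^ (s - 1) * cnj (f i * z ^ i))"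
  proof (intro sum.cong refl)
    fix i assume "i \<in> {..<s}"
    then have "i < s" by simp
    then show "f i * z ^ (s - 1 - i) = z ^ (s - 1) * cnj (f i * z ^ i)"
      unfolding unit_power_flip[OF z \<open>i < s\<close>] complex_cnj_mult by (simp only: real mult_ac)
  qed
  finally show ?thesis by (simp add: sum_distrib_left)
qed

text \<open>Evaluate the integer identity \<open>int_seeds_golay\<close> at \<open>z\<close> and
  cancel \<open>z ^ (s - 1)\<close>.\<close>

lemma seed_unit_norm:
  assumes ab: "(a, b) \<in> set int_seeds" and z: "norm (z :: complex) = 1"
  defines "X \<equiv> (\<Sum>i<length a. of_int (a ! i) * z ^ i)" and "Y \<equiv> (\<Sum>i<length a. of_int (b ! i) * z ^ i)"
  shows "X * cnj X + Y * cnj Y = 2 * of_nat (length a)"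
proof -
  define s where "s = length a"
  have len: "length b = s" "0 < s" using bspec[OF int_seeds_basic ab] by (auto simp: s_def)
  have h: "horner_sum of_int z c = (\<Sum>i<s. of_int (c ! i) * z ^ i)" if "length c = s" for c
    using that by (simp add: horner_sum_eq_sum atLeast0LessThan)
  have hr: "horner_sum of_int z (rev c) = z ^ (s - 1) * cnj (\<Sum>i<s. of_int (c ! i) * z ^ i)"
    if "length c = s" for c
  proof -
    have "horner_sum of_int z (rev c) = (\<Sum>i<s. of_int (c ! (s - 1 - i)) * z ^ i)"
      using that by (subst h) (auto intro!: sum.cong simp: rev_nth)
    then show ?thesis using sum_flip_unit[OF z, of s "\<lambda>i. of_int (c ! i)"] by simp
  qed
  have rep: "horner_sum of_int z (replicate m 0) = 0" for m by (induction m) auto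
  have "horner_sum of_int z (list_add (list_conv a (rev a)) (list_conv b (rev b)))
      = X * (z ^ (s - 1) * cnj X) + Y * (z ^ (s - 1) * cnj Y)"
    unfolding horner_list_add horner_list_conv using h[of a] h[of b] hr[of a] hr[of b] len
      by (simp only: X_def Y_def s_def)
  moreover have "list_add (list_conv a (rev a)) (list_conv b (rev b))
      = replicate (s - 1) 0 @ 2 * int s # replicate (s - 1) 0"
    using bspec[OF int_seeds_golay ab] by (simp add: s_def)
  ultimately have eq: "z ^ (s - 1) * (X * cnj X + Y * cnj Y) = z ^ (s - 1) * (2 * of_nat s)"
    by (simp add: horner_sum_append rep algebra_simps)
  have "z ^ (s - 1) \<noteq> 0" using z by auto
  from iffD1[OF mult_left_cancel[OF this] eq] show ?thesis by (simp only: s_def)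
qed

text \<open>\<open>U + V\<close> and \<open>U - V\<close> are, up to unimodular factors and conjugation, the evaluations of \<open>A\<close> and \<open>B\<close>.\<close>

lemma seed_halves_unit_norm:
  assumes ch: "(A, B, \<epsilon>, \<delta>) \<in> seed_choices s" and z: "norm (z :: complex) = 1"
  defines "U \<equiv> (\<Sum>i<s. (if same A B i then coef \<delta> A B i else 0) * z ^ i)"
    and "V \<equiv> (\<Sum>i<s. (if same A B i then 0 else coef \<delta> A B i) * z ^ i)"
  shows "U * cnj U + V * cnj V = of_nat s"
proof -
  note b = seed_choice_basic[OF ch]
  obtain a b where ab: "(a, b) \<in> set int_seeds" "A = map of_int a" "B = map of_int b" "length a = s"
    using ch by (rule seed_choice_int) blast
  have len: "length b = s" using b(2) ab(3) by simp
  define X where "X = (\<Sum>i<s. A ! i * z ^ i)"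
  define Y where "Y = (\<Sum>i<s. B ! i * z ^ i)"
  have XY: "X * cnj X + Y * cnj Y = 2 * of_nat s"
    using seed_unit_norm[OF ab(1) z] ab(2-4) len by (simp add: X_def Y_def)
  have real: "cnj (A ! i) = A ! i" "cnj (B ! i) = B ! i" if "i < s" for i
    using b(7,8)[OF that] by auto
  define m where "m = z ^ (s - 1)"
  have m: "m * cnj m = 1" unfolding m_def using z by (intro unit_cnj) (simp add: norm_power)
  have plus: "U + V = (\<Sum>i<s. coef \<delta> A B i * z ^ i)"
    unfolding U_def V_def sum.distrib[symmetric] by (intro sum.cong) auto
  have minus: "U - V = (\<Sum>i<s. (if same A B i then coef \<delta> A B i else - coef \<delta> A B i) * z ^ i)"
    unfolding U_def V_def sum_subtractf[symmetric] by (intro sum.cong) auto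
  \<comment> \<open>For \<open>\<delta> = 1\<close> this is just the definition of
    \<open>same\<close> for signs; for \<open>\<delta> = -1\<close> it uses the quadruple product
    rule.\<close>
  have flip: "(if same A B i then coef \<delta> A B i else - coef \<delta> A B i) =
      (if \<delta> = 1 then B ! (s - 1 - i) else - (A ! (s - 1 - i)))" if i: "i < s" for i
  proof -
    define x y u v where vars: "x = A ! i" "y = B ! i" "u = A ! (s - 1 - i)" "v = B ! (s - 1 - i)"
    have j: "s - 1 - i < s" using i by simp
    have same: "same A B i \<longleftrightarrow> x = v" by (simp add: same_def vars b(1))
    have pm: "pm_one x" "pm_one y" "pm_one u" "pm_one v"
      using b(7,8)[OF i] b(7,8)[OF j] by (simp_all only: vars)
    have prod: "x * y * (u * v) = -1" using b(9)[OF i] by (simp only: vars)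
    show ?thesis unfolding coef_def same vars[symmetric] using pm prod by auto
  qed
  have minus': "U - V = (\<Sum>i<s. (if \<delta> = 1 then B ! (s - 1 - i) else - (A ! (s - 1 - i))) * z ^ i)"
    unfolding minus using flip by (intro sum.cong) auto
  have "(U + V) * cnj (U + V) + (U - V) * cnj (U - V) = 2 * of_nat s"
  proof (cases "\<delta> = 1")
    case True
    have "U + V = X" using True by (simp add: plus coef_def X_def)
    moreover have "U - V = m * cnj Y"
      using True sum_flip_unit[OF z, of s "\<lambda>i. B ! i"] real by (simp add: minus' Y_def m_def)
    ultimately have "(U + V) * cnj (U + V) + (U - V) * cnj (U - V) = X * cnj X + (m * cnj m) * (Y * cnj Y)"
      by (simp add: mult_ac)
    then show ?thesis using XY m by simp
  next
    case False
    have "U + V = Y" using False by (simp add: plus coef_def Y_def)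
    moreover have "U - V = - (m * cnj X)"
      using False sum_flip_unit[OF z, of s "\<lambda>i. A ! i"] real by (simp add: minus' X_def m_def sum_negf)
    ultimately have "(U + V) * cnj (U + V) + (U - V) * cnj (U - V) = Y * cnj Y + (m * cnj m) * (X * cnj X)"
      by (simp add: mult_ac)
    then show ?thesis using XY m by (simp add: add.commute)
  qed
  \<comment> \<open>The parallelogram law.\<close>
  moreover have "(U + V) * cnj (U + V) + (U - V) * cnj (U - V) = 2 * (U * cnj U + V * cnj V)"
    by (simp add: algebra_simps)
  ultimately have "2 * (U * cnj U + V * cnj V) = 2 * of_nat s" by (simp only:)
  then show ?thesis by (subst (asm) mult_left_cancel) simp_all
qed

section \<open>Generating functions of arrays on the unit torus\<close>

definition gen :: "nat list \<Rightarrow> (nat list \<Rightarrow> complex) \<Rightarrow> (nat \<Rightarrow> complex) \<Rightarrow> complex" where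
  "gen ds g z = (\<Sum>ix\<in>box ds. g ix * (\<Prod>k<length ds. z k ^ (ix ! k)))"

lemma gen_snoc:
  "gen (ds @ [s]) g z = (\<Sum>i<s. gen ds (\<lambda>j. g (j @ [i])) z * z (length ds) ^ i)"
proof -
  have "gen (ds @ [s]) g z = (\<Sum>(j, i)\<in>box ds \<times> {..<s}. g (j @ [i]) *
      (\<Prod>k<Suc (length ds). z k ^ ((j @ [i]) ! k)))"
    unfolding gen_def box_snoc by (subst sum.reindex) (auto simp: inj_on_def intro!: sum.cong)
  also have "\<dots> = (\<Sum>(j, i)\<in>box ds \<times> {..<s}. g (j @ [i]) *
      (\<Prod>k<length ds. z k ^ (j ! k)) * z (length ds) ^ i)"
  proof (intro sum.cong refl, clarify)
    fix j i assume "j \<in> box ds"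
    then have l: "length j = length ds" by (rule length_box)
    then have "(\<Prod>k<length ds. z k ^ ((j @ [i]) ! k)) = (\<Prod>k<length ds. z k ^ (j ! k))"
      by (intro prod.cong) (auto simp: nth_append)
    with l show "g (j @ [i]) * (\<Prod>k<Suc (length ds). z k ^ ((j @ [i]) ! k)) =
        g (j @ [i]) * (\<Prod>k<length ds. z k ^ (j ! k)) * z (length ds) ^ i"
      by (simp add: nth_append mult.assoc)
  qed
  also have "\<dots> = (\<Sum>j\<in>box ds. \<Sum>i<s. g (j @ [i]) * (\<Prod>k<length ds. z k ^ (j ! k)) * z (length ds) ^ i)"
    by (rule sum.cartesian_product[symmetric])
  also have "\<dots> = (\<Sum>i<s. gen ds (\<lambda>j. g (j @ [i])) z * z (length ds) ^ i)"
    unfolding gen_def sum_distrib_right by (rule sum.swap)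
  finally show ?thesis .
qed

lemma gen_flip:
  assumes z: "\<And>k. norm (z k) = 1" and real: "\<And>ix. ix \<in> box ds \<Longrightarrow> cnj (g ix) = g ix"
  shows "gen ds (\<lambda>ix. g (flip_index ds ix)) z = (\<Prod>k<length ds. z k ^ (ds ! k - 1)) * cnj (gen ds g z)"
proof -
  have bij: "bij_betw (flip_index ds) (box ds) (box ds)"
    by (intro bij_betw_byWitness[where f' = "flip_index ds"]) (auto simp: flip_flip_index flip_index_in_box)
  have "gen ds (\<lambda>ix. g (flip_index ds ix)) z =
      (\<Sum>ix\<in>box ds. g ix * (\<Prod>k<length ds. z k ^ (flip_index ds ix ! k)))"
    unfolding gen_def
    by (rule sum.reindex_bij_betw[OF bij, symmetric, THEN trans]) (intro sum.cong, auto simp: flip_flip_index)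
  also have "\<dots> = (\<Sum>ix\<in>box ds. (\<Prod>k<length ds. z k ^ (ds ! k - 1)) *
      cnj (g ix * (\<Prod>k<length ds. z k ^ (ix ! k))))"
  proof (intro sum.cong refl)
    fix ix assume ix: "ix \<in> box ds"
    have "(\<Prod>k<length ds. z k ^ (flip_index ds ix ! k)) =
        (\<Prod>k<length ds. z k ^ (ds ! k - 1) * cnj (z k ^ (ix ! k)))"
    proof (intro prod.cong refl)
      fix k assume "k \<in> {..<length ds}"
      then have *: "ix ! k < ds ! k" "flip_index ds ix ! k = ds ! k - 1 - ix ! k"
        using ix by (auto simp: box_def flip_index_def)
      show "z k ^ (flip_index ds ix ! k) = z k ^ (ds ! k - 1) * cnj (z k ^ (ix ! k))"
        unfolding *(2) by (rule unit_power_flip[OF z *(1)])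
    qed
    then show "g ix * (\<Prod>k<length ds. z k ^ (flip_index ds ix ! k)) =
        (\<Prod>k<length ds. z k ^ (ds ! k - 1)) * cnj (g ix * (\<Prod>k<length ds. z k ^ (ix ! k)))"
      using real[OF ix] by (simp add: prod.distrib cnj_prod)
  qed
  finally show ?thesis by (simp add: gen_def sum_distrib_left)
qed

text \<open>Up to the unimodular \<open>m\<close>, a step sends the values \<open>C\<close>,
  \<open>D\<close> to \<open>U C + \<epsilon> V D\<close> and
  \<open>V cnj C - \<epsilon> U cnj D\<close>. The mixed terms of the squared moduli cancel, leaving
  the factor \<open>s\<close>; the start value is 1 + 1.\<close>

lemma build_unit_norm:
  assumes "valid cs" and z: "\<And>k. norm (z k) = 1"
  shows "gen (lens cs) (G_of cs) z * cnj (gen (lens cs) (G_of cs) z)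
    + gen (lens cs) (K_of cs) z * cnj (gen (lens cs) (K_of cs) z) = 2 * of_nat (prod_list (lens cs))"
  using assms(1)
proof (induction cs rule: rev_induct)
  case Nil
  then show ?case by (simp add: gen_def box_Nil build_Nil)
next
  case (snoc ch cs)
  obtain A B \<epsilon> \<delta> where ch: "ch = (A, B, \<epsilon>, \<delta>)" by (cases ch)
  obtain s where seed: "(A, B, \<epsilon>, \<delta>) \<in> seed_choices s" using snoc.prems ch by (auto simp: valid_snoc)
  note b = seed_choice_basic[OF seed]
  note v = snoc.prems[unfolded ch]
  have vcs: "valid cs" using v by (simp add: valid_snoc)
  define w where "w = z (length cs)"
  define U where "U = (\<Sum>i<s. (if same A B i then coef \<delta> A B i else 0) * w ^ i)"
  define V where "V = (\<Sum>i<s. (if same A B i then 0 else coef \<delta> A B i) * w ^ i)"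
  have UV: "U * cnj U + V * cnj V = of_nat s"
    unfolding U_def V_def w_def by (rule seed_halves_unit_norm[OF seed z])
  define C where "C = gen (lens cs) (G_of cs) z"
  define D where "D = gen (lens cs) (K_of cs) z"
  define m where "m = (\<Prod>k<length cs. z k ^ (lens cs ! k - 1))"
  have m: "m * cnj m = 1" unfolding m_def
    by (intro unit_cnj) (simp add: norm_power z flip: prod_norm)
  have real: "cnj (G_of cs ix) = G_of cs ix" "cnj (K_of cs ix) = K_of cs ix" if "ix \<in> box (lens cs)" for ix
    using build_pm_one[OF vcs that] by auto
  have Cf: "gen (lens cs) (\<lambda>j. G_of cs (flip_index (lens cs) j)) z = m * cnj C"
    using gen_flip[of z "lens cs" "G_of cs"] z real by (simp add: m_def C_def)
  have Df: "gen (lens cs) (\<lambda>j. K_of cs (flip_index (lens cs) j)) z = m * cnj D"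
    using gen_flip[of z "lens cs" "K_of cs"] z real by (simp add: m_def D_def)
  have lin: "gen (lens cs) (\<lambda>j. c * g j) z = c * gen (lens cs) g z" for c g
    by (simp add: gen_def sum_distrib_left mult.assoc)
  have "gen (lens (cs @ [ch])) (G_of (cs @ [ch])) z = U * C + \<epsilon> * V * D"
  proof -
    have "gen (lens cs) (\<lambda>j. G_of (cs @ [ch]) (j @ [i])) z =
        (if same A B i then coef \<delta> A B i * C else \<epsilon> * coef \<delta> A B i * D)" if "i < s" for i
    proof -
      have "gen (lens cs) (\<lambda>j. G_of (cs @ [ch]) (j @ [i])) z = gen (lens cs)
        (\<lambda>j. if same A B i then coef \<delta> A B i * G_of cs j else (\<epsilon> * coef \<delta> A B i) * K_of cs j) z"
        using build_snoc_entries(1)[OF v, of _ i] that b(1)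
        unfolding gen_def ch by (intro sum.cong) auto
      then show ?thesis using lin by (simp add: C_def D_def)
    qed
    then have "gen (lens (cs @ [ch])) (G_of (cs @ [ch])) z =
        (\<Sum>i<s. (if same A B i then coef \<delta> A B i * C else \<epsilon> * coef \<delta> A B i * D) * w ^ i)"
      using b(1) by (simp add: ch gen_snoc w_def)
    also have "\<dots> = U * C + \<epsilon> * V * D"
      unfolding U_def V_def sum_distrib_left sum_distrib_right sum.distrib[symmetric]
      by (intro sum.cong) auto
    finally show ?thesis .
  qed
  moreover have "gen (lens (cs @ [ch])) (K_of (cs @ [ch])) z = m * (V * cnj C - \<epsilon> * U * cnj D)"
  proof -
    have "gen (lens cs) (\<lambda>j. K_of (cs @ [ch]) (j @ [i])) z =
        (if same A B i then - \<epsilon> * coef \<delta> A B i * (m * cnj D) else coef \<delta> A B i * (m * cnj C))" if "i < s" for i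
    proof -
      have "gen (lens cs) (\<lambda>j. K_of (cs @ [ch]) (j @ [i])) z = gen (lens cs)
        (\<lambda>j. if same A B i then (- \<epsilon> * coef \<delta> A B i) * K_of cs (flip_index (lens cs) j)
          else coef \<delta> A B i * G_of cs (flip_index (lens cs) j)) z"
        using build_snoc_entries(2)[OF v, of _ i] that b(1)
        unfolding gen_def ch by (intro sum.cong) auto
      also have "\<dots> = (if same A B i then - \<epsilon> * coef \<delta> A B i * (m * cnj D) else coef \<delta> A B i * (m * cnj C))"
        unfolding Cf[symmetric] Df[symmetric] lin[symmetric] by simp
      finally show ?thesis .
    qed
    then have "gen (lens (cs @ [ch])) (K_of (cs @ [ch])) z =
        (\<Sum>i<s. (if same A B i then - \<epsilon> * coef \<delta> A B i * (m * cnj D) else coef \<delta> A B i * (m * cnj C)) * w ^ i)"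
      using b(1) by (simp add: ch gen_snoc w_def)
    also have "\<dots> = m * (V * cnj C - \<epsilon> * U * cnj D)"
      unfolding U_def V_def sum_distrib_left sum_distrib_right sum_subtractf[symmetric]
      by (intro sum.cong) auto
    finally show ?thesis .
  qed
  moreover have "(U * C + \<epsilon> * V * D) * cnj (U * C + \<epsilon> * V * D)
      + m * (V * cnj C - \<epsilon> * U * cnj D) * cnj (m * (V * cnj C - \<epsilon> * U * cnj D))
      = (U * cnj U + V * cnj V) * (C * cnj C + D * cnj D)"
  proof -
    have e: "cnj \<epsilon> = \<epsilon>" "\<epsilon> * \<epsilon> = 1" using b(5) by auto
    have "m * (V * cnj C - \<epsilon> * U * cnj D) * cnj (m * (V * cnj C - \<epsilon> * U * cnj D))
        = (m * cnj m) * ((V * cnj C - \<epsilon> * U * cnj D) * (cnj V * C - \<epsilon> * cnj U * D))"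
      by (simp add: e mult_ac)
    also have "\<dots> = V * cnj V * (C * cnj C) + (\<epsilon> * \<epsilon>) * (U * cnj U) * (D * cnj D)
        - \<epsilon> * (V * cnj C * cnj U * D) - \<epsilon> * (U * cnj D * cnj V * C)"
      unfolding m by (simp add: algebra_simps)
    finally have 1: "m * (V * cnj C - \<epsilon> * U * cnj D) * cnj (m * (V * cnj C - \<epsilon> * U * cnj D)) = \<dots>" .
    have 2: "(U * C + \<epsilon> * V * D) * cnj (U * C + \<epsilon> * V * D) = U * cnj U * (C * cnj C)
        + (\<epsilon> * \<epsilon>) * (V * cnj V) * (D * cnj D)
        + \<epsilon> * (V * cnj C * cnj U * D) + \<epsilon> * (U * cnj D * cnj V * C)"
      by (simp add: e(1) algebra_simps)
    show ?thesis unfolding 1 2 e(2) by (simp add: algebra_simps)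
  qed
  ultimately show ?case
    using snoc.IH[OF vcs] UV b(1) by (simp add: ch C_def D_def)
qed

text \<open>Positional scaling replaces \<open>z k\<close> by \<open>- z k\<close> for
  \<open>k\<close> in \<open>T\<close>, which stays on the unit circle.\<close>

lemma gen_scaled:
  assumes "T \<subseteq> {..<length ds}"
  shows "gen ds (scaled T \<eta> g) z = \<eta> * gen ds g (\<lambda>k. if k \<in> T then - z k else z k)"
proof -
  have "(\<Prod>k\<in>T. (-1) ^ (ix ! k)) * (\<Prod>k<length ds. z k ^ (ix ! k)) =
      (\<Prod>k<length ds. (if k \<in> T then - z k else z k) ^ (ix ! k))" for ix
  proof -
    have "(\<Prod>k\<in>T. (-1) ^ (ix ! k)) = (\<Prod>k<length ds. if k \<in> T then (-1) ^ (ix ! k) else 1 :: complex)"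
      using assms by (simp add: prod.If_cases Int_absorb1)
    then show ?thesis
      by (auto simp: prod.distrib[symmetric] power_minus[of "z _"] intro!: prod.cong)
  qed
  then show ?thesis
    by (simp add: gen_def scaled_def sum_distrib_left mult_ac)
qed

text \<open>The weights \<open>W k\<close> are the products of the preceding radices. Only their
  existence, independent of the digits, is used later.\<close>

lemma mixval_linear:
  "distinct \<pi> \<Longrightarrow> \<exists>W. \<forall>g. mixval (map f \<pi>) (map g \<pi>) = (\<Sum>k\<in>set \<pi>. W k * g k)"
proof (induction \<pi>)
  case (Cons k \<pi>)
  then obtain W where W: "\<forall>g. mixval (map f \<pi>) (map g \<pi>) = (\<Sum>k\<in>set \<pi>. W k * g k)" by auto
  have "mixval (map f (k # \<pi>)) (map g (k # \<pi>)) =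
      (\<Sum>j\<in>set (k # \<pi>). (if j = k then 1 else f k * W j) * g j)" for g
  proof -
    have "(\<Sum>j\<in>set \<pi>. (if j = k then 1 else f k * W j) * g j) = (\<Sum>j\<in>set \<pi>. f k * (W j * g j))"
      using Cons.prems by (intro sum.cong) auto
    then show ?thesis using Cons.prems W by (simp add: sum_distrib_left)
  qed
  then show ?case by (intro exI[of _ "\<lambda>j. if j = k then 1 else f k * W j"]) blast
qed simp

text \<open>Projection is the substitution of \<open>z ^ W k\<close> for variable \<open>k\<close>.
  Since \<open>W\<close> is chosen before \<open>g\<close> and \<open>x\<close>, the same
  substitution serves both sequences of a pair.\<close>

lemma represents_unit_sum:
  assumes \<pi>: "perm_list \<pi> (length ds)"
  shows "\<exists>W. \<forall>g x z. represents ds \<pi> g x \<longrightarrow> (\<Sum>p<prod_list ds. x ! p * z ^ p) = gen ds g (\<lambda>k. z ^ W k)"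
proof -
  obtain W where W: "\<forall>g. mixval (map ((!) ds) \<pi>) (map g \<pi>) = (\<Sum>k\<in>set \<pi>. W k * g k)"
    using mixval_linear[of \<pi> "(!) ds"] \<pi> by (auto simp: perm_list_def)
  have "(\<Sum>p<prod_list ds. x ! p * z ^ p) = gen ds g (\<lambda>k. z ^ W k)" if "represents ds \<pi> g x" for g x z
  proof -
    have "(\<Sum>p<prod_list ds. x ! p * z ^ p) = (\<Sum>ix\<in>box ds. x ! pos ds \<pi> ix * z ^ pos ds \<pi> ix)"
      by (rule sum.reindex_bij_betw[OF pos_bij[OF \<pi>], symmetric])
    also have "\<dots> = gen ds g (\<lambda>k. z ^ W k)"
      unfolding gen_def
    proof (intro sum.cong refl)
      fix ix assume "ix \<in> box ds"
      then have "x ! pos ds \<pi> ix = g ix" using that by (simp add: represents_def)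
      moreover have "pos ds \<pi> ix = (\<Sum>k<length ds. W k * ix ! k)"
        using W \<pi> by (simp add: pos_def perm_list_def)
      ultimately show "x ! pos ds \<pi> ix * z ^ pos ds \<pi> ix = g ix * (\<Prod>k<length ds. (z ^ W k) ^ (ix ! k))"
        by (simp add: power_sum power_mult)
    qed
    finally show ?thesis .
  qed
  then show ?thesis by blast
qed

section \<open>From the unit circle to autocorrelations\<close>

lemma infinite_unit_circle: "infinite {z :: complex. norm z = 1}"
proof
  assume fin: "finite {z :: complex. norm z = 1}"
  \<comment> \<open>There are \<open>n\<close> roots of unity of order dividing \<open>n\<close>,
    one more than the supposed number of points on the circle.\<close>
  define n where "n = Suc (card {z :: complex. norm z = 1})"
  have "{z :: complex. z ^ n = 1} \<subseteq> {z. norm z = 1}"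
  proof clarify
    fix z :: complex assume "z ^ n = 1"
    then have "norm z ^ n = 1" by (metis norm_one norm_power)
    then have "norm z ^ n = 1 ^ n" by simp
    then show "norm z = 1" by (rule power_eq_imp_eq_base) (simp_all add: n_def)
  qed
  then have "card {z :: complex. z ^ n = 1} \<le> card {z :: complex. norm z = 1}"
    using fin by (rule card_mono[rotated])
  moreover have "card {z :: complex. z ^ n = 1} = n"
    by (rule card_roots_unity_eq) (simp add: n_def)
  ultimately show False by (simp add: n_def)
qed

lemma poly_Poly: "poly (Poly xs) z = (\<Sum>i<length xs. xs ! i * (z :: complex) ^ i)"
proof (induction xs)
  case (Cons x xs)
  then show ?case
    by (simp add: sum.lessThan_Suc_shift sum_distrib_left mult_ac del: sum.lessThan_Suc)
qed simp

text \<open>Shift \<open>u\<close> pairs entry \<open>i\<close> with entry \<open>i + u\<close>,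
  which sits at place \<open>n - 1 - i - u\<close> of the reversed list; the exponents add up to
  \<open>n - 1 - u\<close>. Negative shifts are included.\<close>

lemma autocorr_coeff:
  assumes real: "\<And>i. i < length x \<Longrightarrow> cnj (x ! i) = x ! i" and u: "u < int (length x)"
  shows "autocorr x u = coeff (Poly x * Poly (rev x)) (nat (int (length x) - 1 - u))"
proof -
  define n k where "n = length x" and "k = nat (int (length x) - 1 - u)"
  have k: "int k = int n - 1 - u" using u by (simp add: k_def n_def)
  have summand: "entry x (int i) * cnj (entry x (int i + u)) =
      (if i \<le> k then x ! i * nth_default 0 (rev x) (k - i) else 0)" if i: "i < n" for i
  proof -
    \<comment> \<open>The partner index may fall off either end. Below 0 the reversed list yields
      its default 0, beyond the end the term has \<open>i > k\<close> and is absent from the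
      convolution.\<close>
    consider "int i + u < 0" | "0 \<le> int i + u" "int i + u < int n" | "int n \<le> int i + u" by linarith
    then show ?thesis
    proof cases
      case 1
      then have "n \<le> k - i" "i \<le> k" using k by linarith+
      with 1 show ?thesis by (simp add: entry_def nth_default_beyond n_def)
    next
      case 2
      define j where "j = nat (int i + u)"
      have j: "int j = int i + u" "j < n" using 2 by (auto simp: j_def)
      have ki: "k - i = n - 1 - j" "i \<le> k" "k - i < n" using k j by linarith+
      have "entry x (int i + u) = x ! j" using 2 by (simp add: entry_def j_def n_def)
      moreover have "nth_default 0 (rev x) (k - i) = x ! j"
        using ki j(2) by (simp add: nth_default_nth rev_nth n_def)
      ultimately show ?thesis using ki(2) i j(2) real[of j] by (simp add: entry_def n_def)
    next
      case 3
      then have "\<not> i \<le> k" using k by linarith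
      with 3 show ?thesis by (simp add: entry_def n_def)
    qed
  qed
  have "autocorr x u = (\<Sum>i<n. entry x (int i) * cnj (entry x (int i + u)))"
    unfolding autocorr_def n_def
    by (rule sum.reindex_bij_witness[of _ int nat]) auto
  also have "\<dots> = (\<Sum>i<n. if i \<le> k then x ! i * nth_default 0 (rev x) (k - i) else 0)"
    using summand by (intro sum.cong) auto
  also have "\<dots> = (\<Sum>i\<le>k. nth_default 0 x i * nth_default 0 (rev x) (k - i))"
    by (rule sum.mono_neutral_cong) (auto simp: nth_default_def n_def)
  finally show ?thesis by (simp add: coeff_mult coeff_Poly_eq k_def)
qed

text \<open>The identity on the circle becomes a polynomial with infinitely many roots, hence 0, and
  the autocorrelations are read off from coefficients.\<close>

lemma golay2_if_unit_norm:
  assumes len: "length x = n" "length y = n" "0 < n" and pm: "set x \<subseteq> {1, -1}" "set y \<subseteq> {1, -1}"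
    and norm: "\<And>z. norm z = 1 \<Longrightarrow> (\<Sum>p<n. x ! p * z ^ p) * cnj (\<Sum>p<n. x ! p * z ^ p)
      + (\<Sum>p<n. y ! p * z ^ p) * cnj (\<Sum>p<n. y ! p * z ^ p) = 2 * of_nat n"
  shows "golay2 n (x, y)"
proof -
  have real: "cnj (v ! i) = v ! i" if "set v \<subseteq> {1, -1}" "i < length v" for v :: "complex list" and i
    using that nth_mem[of i v] by fastforce
  define P where "P = Poly x * Poly (rev x) + Poly y * Poly (rev y) - monom (2 * of_nat n) (n - 1)"
  have "poly P z = 0" if z: "norm z = 1" for z
  proof -
    have rv: "poly (Poly (rev v)) z = z ^ (n - 1) * cnj (\<Sum>i<n. v ! i * z ^ i)"
      if "length v = n" "set v \<subseteq> {1, -1}" for v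
    proof -
      have "poly (Poly (rev v)) z = (\<Sum>i<n. v ! (n - 1 - i) * z ^ i)"
        unfolding poly_Poly using that(1) by (intro sum.cong) (auto simp: rev_nth)
      then show ?thesis using sum_flip_unit[OF z, of n "(!) v"] real[OF that(2)] that(1) by simp
    qed
    define X Y where "X = (\<Sum>i<n. x ! i * z ^ i)" and "Y = (\<Sum>i<n. y ! i * z ^ i)"
    have "poly P z = z ^ (n - 1) * (X * cnj X + Y * cnj Y - 2 * of_nat n)"
      using rv[OF len(1) pm(1)] rv[OF len(2) pm(2)] len
      by (simp add: P_def poly_Poly poly_monom X_def Y_def algebra_simps)
    then show ?thesis using norm[OF z] by (simp add: X_def Y_def)
  qed
  then have "{z. norm z = 1} \<subseteq> {z. poly P z = 0}" by blast
  then have "P = 0"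
    using infinite_unit_circle poly_roots_finite finite_subset by blast
  have "autocorr x u + autocorr y u = 0" if "u \<noteq> 0" for u
  proof (cases "u < int n")
    case True
    have "autocorr x u + autocorr y u = coeff (P + monom (2 * of_nat n) (n - 1)) (nat (int n - 1 - u))"
      using autocorr_coeff[of x u] autocorr_coeff[of y u] True real pm len by (simp add: P_def)
    \<comment> \<open>As \<open>u\<close> is nonzero, the coefficient index differs from
      \<open>n - 1\<close>, the only exponent in the monomial.\<close>
    also have "\<dots> = 0" using \<open>P = 0\<close> True that len(3) by auto
    finally show ?thesis .
  next
    case False
    then show ?thesis using len by (simp add: autocorr_def entry_def)
  qed
  then show ?thesis using len pm by (simp add: golay2_def)
qed

section \<open>Counting the choices\<close>

lemma perm_list_permutes:
  "\<sigma> permutes {..<r} \<Longrightarrow> perm_list (map \<sigma> [0..<r]) r"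
  using permutes_image[of \<sigma> "{..<r}"]
  by (auto simp: perm_list_def distinct_map atLeast0LessThan permutes_inj_on)

lemma position_eq_pos:
  assumes "length ix = length ds"
  shows "position ds \<sigma> ix = pos ds (map \<sigma> [0..<length ds]) ix"
  by (simp add: position_def pos_def mixval_eq_sum)

lemma projects_to_iff_represents:
  assumes "dims C = ds"
  shows "projects_to \<sigma> (positional_scaling T (array_scale \<eta> C)) x \<longleftrightarrow>
    represents ds (map \<sigma> [0..<length ds]) (scaled T \<eta> (ent C)) x"
  using assms by (auto simp: projects_to_def represents_def positional_scaling_def array_scale_def
    scaled_def position_eq_pos length_box)

lemma represented_golay:
  assumes v: "valid cs" and \<pi>: "perm_list \<pi> (length cs)" and T: "T \<subseteq> {..<length cs}"
    and pm: "pm_one \<eta>" "pm_one \<kappa>"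
    and x: "represents (lens cs) \<pi> (scaled T \<eta> (G_of cs)) x"
    and y: "represents (lens cs) \<pi> (scaled T \<kappa> (K_of cs)) y"
  shows "golay2 (prod_list (lens cs)) (x, y)"
proof (rule golay2_if_unit_norm)
  have \<pi>': "perm_list \<pi> (length (lens cs))" using \<pi> by simp
  have fin: "finite T" using T finite_subset by blast
  show "length x = prod_list (lens cs)" "length y = prod_list (lens cs)"
    using x y by (simp_all add: represents_def)
  show "0 < prod_list (lens cs)"
    using lens_valid[OF v] by (intro gr0I) (fastforce simp: prod_list_zero_iff)
  have entries: "set v \<subseteq> {1, -1}"
    if rep: "represents (lens cs) \<pi> (scaled T \<theta> g) v" and "pm_one \<theta>" "\<And>ix. ix \<in> box (lens cs) \<Longrightarrow> pm_one (g ix)"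
    for v \<theta> g
  proof
    fix e assume "e \<in> set v"
    then obtain p where p: "p < prod_list (lens cs)" "v ! p = e"
      using rep by (auto simp: in_set_conv_nth represents_def)
    obtain ix where ix: "ix \<in> box (lens cs)" "pos (lens cs) \<pi> ix = p"
      by (rule pos_surj[OF \<pi>' p(1)])
    then have "e = scaled T \<theta> g ix" using rep p(2) by (auto simp: represents_def)
    then show "e \<in> {1, -1}"
      unfolding scaled_def using that(2,3) ix(1) by (simp only:) (intro pm_one_mult pm_one_prod_signs fin, auto)
  qed
  show "set x \<subseteq> {1, -1}" "set y \<subseteq> {1, -1}"
    using entries[OF x pm(1)] entries[OF y pm(2)] build_pm_one[OF v] by blast+
  fix z :: complex assume z: "norm z = 1"
  obtain W where W: "\<forall>g x z. represents (lens cs) \<pi> g x \<longrightarrow>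
      (\<Sum>p<prod_list (lens cs). x ! p * z ^ p) = gen (lens cs) g (\<lambda>k. z ^ W k)"
    using represents_unit_sum[OF \<pi>'] by blast
  \<comment> \<open>The point of the torus that accounts for both the projection weights and the
    positional scaling.\<close>
  define z' where "z' k = (if k \<in> T then - (z ^ W k) else z ^ W k)" for k
  have z': "norm (z' k) = 1" for k using z by (simp add: z'_def norm_power)
  have "T \<subseteq> {..<length (lens cs)}" using T by simp
  note scaled = gen_scaled[OF this, of _ _ "\<lambda>k. z ^ W k", folded z'_def]
  define X Y where "X = gen (lens cs) (G_of cs) z'" and "Y = gen (lens cs) (K_of cs) z'"
  have sq: "\<theta> * u * cnj (\<theta> * u) = u * cnj u" if "pm_one \<theta>" for \<theta> u
    using that by auto
  have "(\<Sum>p<prod_list (lens cs). x ! p * z ^ p) = \<eta> * X" "(\<Sum>p<prod_list (lens cs). y ! p * z ^ p) = \<kappa> * Y"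
    using W x y by (simp_all add: scaled X_def Y_def)
  then show "(\<Sum>p<prod_list (lens cs). x ! p * z ^ p) * cnj (\<Sum>p<prod_list (lens cs). x ! p * z ^ p)
      + (\<Sum>p<prod_list (lens cs). y ! p * z ^ p) * cnj (\<Sum>p<prod_list (lens cs). y ! p * z ^ p)
      = 2 * of_nat (prod_list (lens cs))"
    using sq[OF pm(1)] sq[OF pm(2)] build_unit_norm[OF v, of z'] z' by (simp only: X_def Y_def)
qed

section \<open>Records of all choices and their outcomes\<close>

definition seed_lengths :: "nat \<Rightarrow> nat \<Rightarrow> nat \<Rightarrow> nat \<Rightarrow> nat multiset" where
  "seed_lengths a b c d = replicate_mset a 2 + replicate_mset b 10 + replicate_mset c 20 + replicate_mset d 26"

type_synonym params = "nat list \<times> seed_choice list \<times> complex \<times> complex \<times> nat set \<times> (nat \<Rightarrow> nat)"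

definition choices :: "nat multiset \<Rightarrow> params set" where
  "choices M = (SIGMA s:{s. mset s = M}. {cs. list_all2 (\<lambda>sj ch. ch \<in> seed_choices sj) s cs} \<times>
     {1, -1} \<times> {1, -1} \<times> Pow {..<length s} \<times> {\<sigma>. \<sigma> permutes {..<length s}})"

definition produces :: "params \<Rightarrow> complex list \<times> complex list \<Rightarrow> bool" where
  "produces = (\<lambda>(s, cs, \<eta>, \<kappa>, T, \<sigma>) (x, y).
     represents s (map \<sigma> [0..<length s]) (scaled T \<eta> (G_of cs)) x \<and>
     represents s (map \<sigma> [0..<length s]) (scaled T \<kappa> (K_of cs)) y)"

text \<open>The description is definite on \<open>choices M\<close>: projections exist and are
  unique by \<open>represents_exists\<close> and \<open>represents_unique\<close>.\<close>

definition outcome :: "params \<Rightarrow> complex list \<times> complex list" where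
  "outcome p = (SOME xy. produces p xy)"

lemma list_all2_seed_choices:
  "list_all2 (\<lambda>sj ch. ch \<in> seed_choices sj) s cs \<Longrightarrow> valid cs \<and> lens cs = s"
  by (induction rule: list_all2_induct) (auto simp: valid_def lens_def seed_choice_basic(1))

lemma choicesD:
  assumes "(s, cs, \<eta>, \<kappa>, T, \<sigma>) \<in> choices M"
  shows "mset s = M" "list_all2 (\<lambda>sj ch. ch \<in> seed_choices sj) s cs" "valid cs" "s = lens cs"
    "length s = length cs" "pm_one \<eta>" "pm_one \<kappa>" "T \<subseteq> {..<length cs}" "\<sigma> permutes {..<length cs}"
    "perm_list (map \<sigma> [0..<length s]) (length cs)" "perm_list (map \<sigma> [0..<length s]) (length s)"
proof -
  show *: "mset s = M" "list_all2 (\<lambda>sj ch. ch \<in> seed_choices sj) s cs" "pm_one \<eta>" "pm_one \<kappa>"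
    using assms by (auto simp: choices_def)
  show **: "valid cs" "s = lens cs" using list_all2_seed_choices[OF *(2)] by auto
  then show l: "length s = length cs" by simp
  show "T \<subseteq> {..<length cs}" and \<sigma>: "\<sigma> permutes {..<length cs}" using assms l by (auto simp: choices_def)
  show "perm_list (map \<sigma> [0..<length s]) (length cs)" "perm_list (map \<sigma> [0..<length s]) (length s)"
    using perm_list_permutes[OF \<sigma>] l by auto
qed

lemma produces_outcome: "p \<in> choices M \<Longrightarrow> produces p (outcome p)"
proof -
  assume p: "p \<in> choices M"
  obtain s cs \<eta> \<kappa> T \<sigma> where ps: "p = (s, cs, \<eta>, \<kappa>, T, \<sigma>)" by (cases p)
  note d = choicesD[OF p[unfolded ps]]
  obtain x where "represents s (map \<sigma> [0..<length s]) (scaled T \<eta> (G_of cs)) x"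
    using represents_exists[OF d(11)] by blast
  moreover obtain y where "represents s (map \<sigma> [0..<length s]) (scaled T \<kappa> (K_of cs)) y"
    using represents_exists[OF d(11)] by blast
  ultimately have "produces p (x, y)" by (simp add: produces_def ps)
  then show ?thesis unfolding outcome_def by (rule someI)
qed

lemma produces_unique: "p \<in> choices M \<Longrightarrow> produces p xy \<Longrightarrow> xy = outcome p"
proof -
  assume p: "p \<in> choices M" and xy: "produces p xy"
  obtain s cs \<eta> \<kappa> T \<sigma> where ps: "p = (s, cs, \<eta>, \<kappa>, T, \<sigma>)" by (cases p)
  note d = choicesD[OF p[unfolded ps]]
  obtain x y x' y' where e: "xy = (x, y)" "outcome p = (x', y')" by (cases xy, cases "outcome p")
  have "produces p (x, y)" "produces p (x', y')" using xy produces_outcome[OF p] e by auto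
  then show ?thesis
    using represents_unique[OF d(11), of _ x x'] represents_unique[OF d(11), of _ y y'] e
    by (auto simp: produces_def ps)
qed

lemma Gamma_eq_outcomes: "Gamma a b c d = outcome ` choices (seed_lengths a b c d)"
proof (intro equalityI subsetI)
  fix xy assume "xy \<in> Gamma a b c d"
  then obtain x y s cs G K \<eta> \<kappa> T \<sigma> where xy: "xy = (x, y)" "(G, K) = build cs"
    and par: "mset s = seed_lengths a b c d" "list_all2 (\<lambda>sj ch. ch \<in> seed_choices sj) s cs"
      "\<eta> \<in> {1, -1}" "\<kappa> \<in> {1, -1}" "T \<subseteq> {..<length s}" "\<sigma> permutes {..<length s}"
    and xy': "projects_to \<sigma> (positional_scaling T (array_scale \<eta> G)) x"
      "projects_to \<sigma> (positional_scaling T (array_scale \<kappa> K)) y"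
    unfolding Gamma_def seed_lengths_def by blast
  have p: "(s, cs, \<eta>, \<kappa>, T, \<sigma>) \<in> choices (seed_lengths a b c d)"
    using par by (simp add: choices_def)
  note d = choicesD[OF p]
  have GK: "dims G = s" "dims K = s" "G = fst (build cs)" "K = snd (build cs)"
    using dims_build[OF d(3)] d(4) xy(2)[symmetric] by auto
  have "produces (s, cs, \<eta>, \<kappa>, T, \<sigma>) xy"
    using xy' projects_to_iff_represents[OF GK(1)] projects_to_iff_represents[OF GK(2)] GK(3,4)
    by (simp add: produces_def xy)
  then show "xy \<in> outcome ` choices (seed_lengths a b c d)"
    using produces_unique[OF p] p by blast
next
  fix xy assume "xy \<in> outcome ` choices (seed_lengths a b c d)"
  then obtain s cs \<eta> \<kappa> T \<sigma> where p: "(s, cs, \<eta>, \<kappa>, T, \<sigma>) \<in> choices (seed_lengths a b c d)"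
    and xy: "xy = outcome (s, cs, \<eta>, \<kappa>, T, \<sigma>)" by auto
  note d = choicesD[OF p]
  obtain x y where e: "xy = (x, y)" by (cases xy)
  have dims: "dims (fst (build cs)) = s" "dims (snd (build cs)) = s" using dims_build[OF d(3)] d(4) by auto
  have "projects_to \<sigma> (positional_scaling T (array_scale \<eta> (fst (build cs)))) x"
    "projects_to \<sigma> (positional_scaling T (array_scale \<kappa> (snd (build cs)))) y"
    using produces_outcome[OF p, folded xy] e
    by (simp_all add: produces_def projects_to_iff_represents[OF dims(1)] projects_to_iff_represents[OF dims(2)])
  moreover have "T \<subseteq> {..<length s}" "\<sigma> permutes {..<length s}" using d by auto
  ultimately show "xy \<in> Gamma a b c d"
    using d(1,2,6,7) prod.collapse[of "build cs"] unfolding Gamma_def e seed_lengths_def by blast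
qed

text \<open>Allowing two different multisets gives both the injectivity needed to count one
  \<open>Gamma\<close> and the disjointness of the different ones.\<close>

lemma outcome_injective:
  assumes p: "p \<in> choices M" and p': "p' \<in> choices M'" and eq: "outcome p = outcome p'"
  shows "p = p'"
proof -
  obtain s cs \<eta> \<kappa> T \<sigma> where ps: "p = (s, cs, \<eta>, \<kappa>, T, \<sigma>)" by (cases p)
  obtain s' cs' \<eta>' \<kappa>' T' \<sigma>' where ps': "p' = (s', cs', \<eta>', \<kappa>', T', \<sigma>')" by (cases p')
  note d = choicesD[OF p[unfolded ps]] and d' = choicesD[OF p'[unfolded ps']]
  obtain x y where xy: "outcome p = (x, y)" by (cases "outcome p")
  have r: "represents (lens cs) (map \<sigma> [0..<length s]) (scaled T \<eta> (G_of cs)) x"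
    "represents (lens cs) (map \<sigma> [0..<length s]) (scaled T \<kappa> (K_of cs)) y"
    using produces_outcome[OF p] xy by (simp_all add: produces_def ps d(4))
  have r': "represents (lens cs') (map \<sigma>' [0..<length s']) (scaled T' \<eta>' (G_of cs')) x"
    "represents (lens cs') (map \<sigma>' [0..<length s']) (scaled T' \<kappa>' (K_of cs')) y"
    using produces_outcome[OF p'] xy eq by (simp_all add: produces_def ps' d'(4))
  have eqs: "cs = cs' \<and> map \<sigma> [0..<length s] = map \<sigma>' [0..<length s'] \<and> T = T' \<and> \<eta> = \<eta>' \<and> \<kappa> = \<kappa>'"
    using build_injective[OF d(3) d'(3) d(10) d'(10) d(8) d'(8) d(6,7) d'(6,7) r r'] .
  then have ss: "s = s'" using d(4) d'(4) by simp
  \<comment> \<open>The lists of values fix the permutations on the dimensions; elsewhere both are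
    the identity.\<close>
  have "\<sigma> k = \<sigma>' k" for k
  proof (cases "k < length s")
    case True
    with eqs ss show ?thesis by (auto dest!: arg_cong[of _ _ "\<lambda>l. l ! k"])
  next
    case False
    with d(5,9) d'(5,9) ss show ?thesis by (simp add: permutes_def)
  qed
  with eqs ss show ?thesis by (auto simp: ps ps')
qed

lemma card_list_all2:
  "card {cs. list_all2 (\<lambda>s ch. ch \<in> S s) ss cs} = prod_list (map (\<lambda>s. card (S s)) ss)"
proof (induction ss)
  case (Cons s ss)
  have "{cs. list_all2 (\<lambda>s ch. ch \<in> S s) (s # ss) cs} =
      (\<lambda>(c, cs). c # cs) ` (S s \<times> {cs. list_all2 (\<lambda>s ch. ch \<in> S s) ss cs})"
    by (auto simp: list_all2_Cons1 image_iff)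
  then show ?case
    using Cons by (simp add: card_image inj_on_def card_cartesian_product)
qed simp

lemma card_seed_choices:
  "card (seed_choices 2) = 1" "card (seed_choices 10) = 16"
  "card (seed_choices 20) = 8" "card (seed_choices 26) = 8"
proof -
  have eq: "seed_choices s = (\<lambda>((A, B), \<epsilon>, \<delta>). (A, B, \<epsilon>, \<delta>)) `
      (seed_pairs s \<times> (if s = 2 then {1} \<times> {1} else {1, -1} \<times> {1, -1}))" for s
    by (force simp: seed_choices_def image_iff)
  have c: "card (seed_choices s) = card (seed_pairs s) * (if s = 2 then 1 else 4)" for s
    unfolding eq by (subst card_image) (auto simp: inj_on_def card_cartesian_product)
  have p: "card (seed_pairs 2) = 1" "card (seed_pairs 10) = 4"
    "card (seed_pairs 20) = 2" "card (seed_pairs 26) = 2"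
    by (simp_all add: seed_pairs_def star_def A10_1_def B10_1_def A10_2_def B10_2_def B20_def B26_def)
  show "card (seed_choices 2) = 1" "card (seed_choices 10) = 16"
    "card (seed_choices 20) = 8" "card (seed_choices 26) = 8"
    by (simp_all add: c p)
qed

text \<open>One factorial of the total comes from the multinomial count of arrangements and one from
  \<open>\<sigma>\<close>. Each long seed contributes 16 or 8 choices, the signs of \<open>G\<close>
  and \<open>K\<close> contribute 4, and the sets \<open>T\<close> the last power of 2. The product
  form avoids division.\<close>

lemma card_choices:
  "card (choices (seed_lengths a b c d)) * (fact a * fact b * fact c * fact d) =
    (fact (a + b + c + d))\<^sup>2 * (16 ^ b * 8 ^ c * 8 ^ d * 4 * 2 ^ (a + b + c + d))"
proof -
  define M where "M = seed_lengths a b c d"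
  define r where "r = a + b + c + d"
  have size: "size M = r" by (simp add: M_def seed_lengths_def r_def)
  define N where "N = (16 ^ b * 8 ^ c * 8 ^ d * 4 * 2 ^ r * fact r :: nat)"
  have fin: "finite {s. mset s = M}"
    using finite_permutations_of_multiset[of M] by (simp add: permutations_of_multiset_def)
  have one: "card ({cs. list_all2 (\<lambda>sj ch. ch \<in> seed_choices sj) s cs} \<times> {1, -1 :: complex} \<times> {1, -1 :: complex}
      \<times> Pow {..<length s} \<times> {\<sigma>. \<sigma> permutes {..<length s}}) = N" if s: "mset s = M" for s
  proof -
    have len: "length s = r" using s size by (metis size_mset)
    have "prod_list (map (\<lambda>s. card (seed_choices s)) s) = prod_mset (image_mset (\<lambda>s. card (seed_choices s)) (mset s))"
      by (simp flip: prod_mset_prod_list)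
    also have "\<dots> = 16 ^ b * 8 ^ c * 8 ^ d"
      by (simp add: s M_def seed_lengths_def card_seed_choices)
    finally have "card {cs. list_all2 (\<lambda>sj ch. ch \<in> seed_choices sj) s cs} = 16 ^ b * 8 ^ c * 8 ^ d"
      by (simp add: card_list_all2)
    moreover have "card {\<sigma>. \<sigma> permutes {..<length s}} = fact r"
      using card_permutations[of "{..<length s}" r] len by simp
    ultimately show ?thesis by (simp add: card_cartesian_product card_Pow len N_def)
  qed
  have nonfin: "finite ({cs. list_all2 (\<lambda>sj ch. ch \<in> seed_choices sj) s cs} \<times> {1, -1 :: complex} \<times> {1, -1 :: complex}
      \<times> Pow {..<length s} \<times> {\<sigma>. \<sigma> permutes {..<length s}})" if s: "mset s = M" for s
    using one[OF s] by (intro card_ge_0_finite) (simp add: N_def)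
  have "card (choices M) = (\<Sum>s\<in>{s. mset s = M}. N)"
    unfolding choices_def using one nonfin fin by (subst card_SigmaI) auto
  then have "card (choices M) = card (permutations_of_multiset M) * N"
    by (simp add: permutations_of_multiset_def)
  moreover have "card (permutations_of_multiset M) * (fact a * fact b * fact c * fact d) = fact r"
  proof -
    have "(\<Prod>x\<in>set_mset M. fact (count M x) :: nat) = (\<Prod>x\<in>{2, 10, 20, 26}. fact (count M x))"
      by (intro prod.mono_neutral_left) (auto simp: M_def seed_lengths_def not_in_iff)
    also have "\<dots> = fact a * fact b * fact c * fact d"
      by (simp add: M_def seed_lengths_def mult.assoc)
    finally show ?thesis using card_permutations_of_multiset_aux[of M] size by simp
  qed
  ultimately have "card (choices M) * (fact a * fact b * fact c * fact d) = fact r * N"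
    by (metis mult.assoc mult.commute)
  then show ?thesis by (simp add: M_def r_def N_def power2_eq_square mult_ac)
qed

lemma card_Gamma:
  assumes "k \<le> min a b"
  shows "real (card (Gamma (a - k) (b - k) k c)) =
    (fact (a + b + c - k))\<^sup>2 / (fact (a - k) * fact (b - k) * fact k * fact c) * 2 ^ (a + 5 * b + 4 * c - 2 * k + 2)"
proof -
  \<comment> \<open>Writing \<open>a = k + a'\<close> and \<open>b = k + b'\<close> removes the
    truncated subtractions, also in the exponent.\<close>
  obtain a' b' where ab: "a = k + a'" "b = k + b'"
    using assms by (metis le_Suc_ex min.boundedE)
  define r where "r = a' + b' + k + c"
  have "inj_on outcome (choices (seed_lengths a' b' k c))"
    by (rule inj_onI) (rule outcome_injective)
  then have "card (Gamma a' b' k c) = card (choices (seed_lengths a' b' k c))"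
    by (simp add: Gamma_eq_outcomes card_image)
  then have "card (Gamma a' b' k c) * (fact a' * fact b' * fact k * fact c) =
      (fact r)\<^sup>2 * (16 ^ b' * 8 ^ k * 8 ^ c * 4 * 2 ^ r)"
    by (simp add: card_choices r_def)
  also have "(16 ^ b' * 8 ^ k * 8 ^ c * 4 * 2 ^ r :: nat) = 2 ^ (4 * b' + 3 * k + 3 * c + 2 + r)"
    by (simp add: power_add power_mult)
  finally have "real (card (Gamma a' b' k c) * (fact a' * fact b' * fact k * fact c)) =
      real ((fact r)\<^sup>2 * 2 ^ (4 * b' + 3 * k + 3 * c + 2 + r))" by (simp only:)
  then have "real (card (Gamma a' b' k c)) * (fact a' * fact b' * fact k * fact c) =
      (fact r)\<^sup>2 * 2 ^ (4 * b' + 3 * k + 3 * c + 2 + r)" by simp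
  then have "real (card (Gamma a' b' k c)) =
      (fact r)\<^sup>2 / (fact a' * fact b' * fact k * fact c) * 2 ^ (4 * b' + 3 * k + 3 * c + 2 + r)"
    by (simp add: field_simps)
  moreover have "a - k = a'" "b - k = b'" "a + b + c - k = r"
    "a + 5 * b + 4 * c - 2 * k + 2 = 4 * b' + 3 * k + 3 * c + 2 + r"
    by (simp_all add: ab r_def)
  ultimately show ?thesis by simp
qed

lemma Gamma_golay:
  assumes "p \<in> Gamma a b c d"
  shows "golay2 (2 ^ a * 10 ^ b * 20 ^ c * 26 ^ d) p"
proof -
  obtain s cs \<eta> \<kappa> T \<sigma> where q: "(s, cs, \<eta>, \<kappa>, T, \<sigma>) \<in> choices (seed_lengths a b c d)"
    and p: "p = outcome (s, cs, \<eta>, \<kappa>, T, \<sigma>)" using assms by (auto simp: Gamma_eq_outcomes)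
  note d = choicesD[OF q]
  obtain x y where e: "p = (x, y)" by (cases p)
  have "golay2 (prod_list (lens cs)) (x, y)"
    using produces_outcome[OF q, folded p]
    by (intro represented_golay[OF d(3,10,8,6,7)]) (simp_all add: produces_def e d(4)[symmetric])
  moreover have "prod_list (lens cs) = prod_mset (mset s)" by (simp add: d(4) prod_mset_prod_list)
  moreover have "prod_mset (mset s) = 2 ^ a * 10 ^ b * 20 ^ c * 26 ^ d"
    by (simp add: d(1) seed_lengths_def)
  ultimately show ?thesis by (simp add: e)
qed

theorem theorem5:
  fixes a b c n :: nat
  assumes "n = 2 ^ a * 10 ^ b * 26 ^ c"
  shows "(\<forall>p \<in> (\<Union>k\<in>{0..min a b}. Gamma (a - k) (b - k) k c). golay2 n p) \<and>
    real (card (\<Union>k\<in>{0..min a b}. Gamma (a - k) (b - k) k c)) =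
      (\<Sum>k=0..min a b. (fact (a + b + c - k))\<^sup>2 / (fact (a - k) * fact (b - k) * fact k * fact c)
         * 2 ^ (a + 5 * b + 4 * c - 2 * k + 2))"
proof (intro conjI ballI)
  fix p assume "p \<in> (\<Union>k\<in>{0..min a b}. Gamma (a - k) (b - k) k c)"
  then obtain k where k: "k \<le> a" "k \<le> b" and p: "p \<in> Gamma (a - k) (b - k) k c" by auto
  then obtain a' b' where ab: "a = k + a'" "b = k + b'" by (metis le_Suc_ex)
  have "(2 ^ (a - k) * 10 ^ (b - k) * 20 ^ k * 26 ^ c :: nat) = n"
    \<comment> \<open>A seed of length 20 replaces one of length 2 and one of length 10, so the
      total length does not depend on \<open>k\<close>.\<close>
    using power_mult_distrib[of "2 :: nat" 10 k] by (simp add: assms ab power_add mult_ac)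
  then show "golay2 n p" using Gamma_golay[OF p] by simp
next
  let ?\<Gamma> = "\<lambda>k. Gamma (a - k) (b - k) k c"
  have fin: "finite (?\<Gamma> k)" if "k \<in> {0..min a b}" for k
  proof (rule card_ge_0_finite)
    have "k \<le> min a b" using that by simp
    then have "0 < real (card (?\<Gamma> k))"
      by (simp only: card_Gamma) (intro mult_pos_pos divide_pos_pos zero_less_power fact_gt_zero, simp)
    then show "0 < card (?\<Gamma> k)" by simp
  qed
  \<comment> \<open>A common element would have one record of choices, whose number of lengths 20
    would be both \<open>k\<close> and \<open>l\<close>.\<close>
  have disj: "?\<Gamma> k \<inter> ?\<Gamma> l = {}" if "k \<noteq> l" for k l
  proof -
    have "False" if xy: "xy \<in> ?\<Gamma> k" "xy \<in> ?\<Gamma> l" for xy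
    proof -
      obtain q where q: "xy = outcome q" "q \<in> choices (seed_lengths (a - k) (b - k) k c)"
        using xy(1) unfolding Gamma_eq_outcomes by (rule imageE)
      obtain q' where q': "xy = outcome q'" "q' \<in> choices (seed_lengths (a - l) (b - l) l c)"
        using xy(2) unfolding Gamma_eq_outcomes by (rule imageE)
      have "q = q'" using q q' by (intro outcome_injective[OF q(2) q'(2)]) simp
      moreover have "mset (fst q) = seed_lengths (a - k) (b - k) k c"
        "mset (fst q') = seed_lengths (a - l) (b - l) l c"
        using q(2) q'(2) by (auto simp: choices_def)
      ultimately have "seed_lengths (a - k) (b - k) k c = seed_lengths (a - l) (b - l) l c" by simp
      then have "count (seed_lengths (a - k) (b - k) k c) 20 = count (seed_lengths (a - l) (b - l) l c) 20"
        by simp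
      then show False using \<open>k \<noteq> l\<close> by (simp add: seed_lengths_def)
    qed
    then show ?thesis by blast
  qed
  have "card (\<Union>k\<in>{0..min a b}. ?\<Gamma> k) = (\<Sum>k=0..min a b. card (?\<Gamma> k))"
    using fin disj by (intro card_UN_disjoint) auto
  then show "real (card (\<Union>k\<in>{0..min a b}. ?\<Gamma> k)) =
      (\<Sum>k=0..min a b. (fact (a + b + c - k))\<^sup>2 / (fact (a - k) * fact (b - k) * fact k * fact c)
         * 2 ^ (a + 5 * b + 4 * c - 2 * k + 2))"
    by (simp only: of_nat_sum) (intro sum.cong refl card_Gamma, simp)
qed

end
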